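(* For every $\varepsilon>0$ there is an online contention resolution scheme for matroids that uses $O_\varepsilon(\log^4 n)$ samples and is $(\frac14-\varepsilon)$-selectable for every matroid on a ground set of size $n$. That is, for every matroid $\mathcal M=(U,\mathcal I)$ with $U=[n]$ and every $x\in\mathcal P_{\mathcal M}$, given $O_\varepsilon(\log^4 n)$ independent samples of $R(x)$ as its only information about $x$, the scheme's output $A$ satisfies $\Pr[i\in A\mid i\in R(x)]\ge \frac14-\varepsilon$ for all $i\in U$.
   Context: For a matroid $\mathcal M=(U,\mathcal I)$, $U=[n]$, its polytope is $\mathcal P_{\mathcal M}=\{x\in[0,1]^n:\sum_{i\in S}x_i\le \mathrm{rank}(S)\ \forall S\subseteq U\}$, where $\mathrm{rank}(S)$ is the size of the largest independent subset of $S$. For $x\in\mathcal P_{\mathcal M}$, $R(x)\subseteq U$ is the random set containing each $i$ independently with probability $x_i$ ("active" elements). An online contention resolution scheme (OCRS) observes the elements in the order $1,\dots,n$, learning upon arrival of $i$ whether $i\in R(x)$; if $i$ is active it must irrevocably decide whether to add $i$ to its output $A$, keeping $A\in\mathcal I$. It is $c$-selectable if for every $x\in\mathcal P_{\mathcal M}$, $\Pr[i\in A\mid i\in R(x)]\ge c$ for every $i\in U$, the probability being over $R(x)$ and the scheme's internal randomness (including its samples). In the limited-information setting the scheme does not know $x$; instead it receives independent samples (realizations) of $R(x)$ beforehand; it "uses $k$ samples" if it receives $k$ such samples. $O_\varepsilon(\cdot)$ hides factors depending only on $\varepsilon$. *)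

theory Defs
  imports "HOL-Probability.Probability" "HOL-Library.Landau_Symbols"
begin

locale matroid =
  fixes U :: "'a set" and \<I> :: "'a set set"
  assumes finite_ground: "finite U"
    and indep_subset_ground: "\<And>S. S \<in> \<I> \<Longrightarrow> S \<subseteq> U"
    and indep_empty: "{} \<in> \<I>"
    and indep_mono: "\<And>S T. T \<in> \<I> \<Longrightarrow> S \<subseteq> T \<Longrightarrow> S \<in> \<I>"
    and indep_augment:
      "\<And>S T. S \<in> \<I> \<Longrightarrow> T \<in> \<I> \<Longrightarrow> card S < card T \<Longrightarrow> \<exists>e\<in>T - S. insert e S \<in> \<I>"

definition matroid_rank :: "'a set set \<Rightarrow> 'a set \<Rightarrow> nat" where
  "matroid_rank \<I> S = Max (card ` {T \<in> \<I>. T \<subseteq> S})"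

text \<open>Points of the cube are functions that are \<^const>\<open>undefined\<close> outside \<open>U\<close>.\<close>

definition matroid_polytope :: "'a set \<Rightarrow> 'a set set \<Rightarrow> ('a \<Rightarrow> real) set" where
  "matroid_polytope U \<I> =
     {x \<in> U \<rightarrow>\<^sub>E {0..1}. \<forall>S\<subseteq>U. (\<Sum>i\<in>S. x i) \<le> real (matroid_rank \<I> S)}"

text \<open>The distribution of the random set \<open>R(x)\<close> of active elements.\<close>

definition active_pmf :: "'a set \<Rightarrow> ('a \<Rightarrow> real) \<Rightarrow> 'a set pmf" where
  "active_pmf U x = map_pmf (\<lambda>f. {i. f i}) (Pi_pmf U False (\<lambda>i. bernoulli_pmf (x i)))"

text \<open>
  A deterministic online policy decides whether to accept an active element \<open>i\<close>, given the set of
  active elements among those that arrived before \<open>i\<close>. Its earlier decisions are a function of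
  that set, so they need not be passed as a further argument.
\<close>

type_synonym policy = "nat set \<Rightarrow> nat \<Rightarrow> bool"

definition policy_output :: "policy \<Rightarrow> nat set \<Rightarrow> nat set" where
  "policy_output \<pi> R = {i \<in> R. \<pi> (R \<inter> {..<i}) i}"

text \<open>
  A scheme for a fixed matroid maps the list of samples to a random policy: all internal randomness
  is drawn before the first arrival. Independent coin tosses made along the way are covered, by
  tossing the coins of all possible histories in advance. The point \<open>x\<close> is not an argument.
\<close>

type_synonym scheme = "nat set list \<Rightarrow> policy pmf"

definition feasible_scheme :: "nat \<Rightarrow> nat set set \<Rightarrow> nat \<Rightarrow> scheme \<Rightarrow> bool" where
  "feasible_scheme n \<I> k sch \<longleftrightarrow>
     (\<forall>Ss. length Ss = k \<and> set Ss \<subseteq> Pow {1..n} \<longrightarrow>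
       (\<forall>\<pi>\<in>set_pmf (sch Ss). \<forall>R\<subseteq>{1..n}. policy_output \<pi> R \<in> \<I>))"

text \<open>
  The joint distribution of \<open>(R(x), A)\<close>; the set \<open>R(x)\<close> is independent of the samples and of the
  internal randomness.
\<close>

definition scheme_outcome :: "nat \<Rightarrow> nat \<Rightarrow> scheme \<Rightarrow> (nat \<Rightarrow> real) \<Rightarrow> (nat set \<times> nat set) pmf" where
  "scheme_outcome n k sch x =
     do {
       Ss \<leftarrow> replicate_pmf k (active_pmf {1..n} x);
       \<pi> \<leftarrow> sch Ss;
       R \<leftarrow> active_pmf {1..n} x;
       return_pmf (R, policy_output \<pi> R)
     }"

text \<open>
  The conditional probability is only meaningful if \<open>i\<close> is active with positive probability,
  i.e. \<open>x i > 0\<close>; \<^const>\<open>cond_prob\<close> would otherwise be \<open>0\<close>.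
\<close>

definition selectable :: "nat \<Rightarrow> nat set set \<Rightarrow> nat \<Rightarrow> scheme \<Rightarrow> real \<Rightarrow> bool" where
  "selectable n \<I> k sch c \<longleftrightarrow>
     (\<forall>x\<in>matroid_polytope {1..n} \<I>. \<forall>i\<in>{1..n}. x i > 0 \<longrightarrow>
       \<P>(\<omega> in scheme_outcome n k sch x. i \<in> snd \<omega> \<bar> i \<in> fst \<omega>) \<ge> c)"

end

theory Submission
  imports Defs "HOL-Real_Asymp.Real_Asymp"
begin

text \<open>
  Only elements of a uniformly random mask are accepted; the masked active set \<open>Q\<close> has marginals \<open>x/2\<close>.
  As in the matroid OCRS of Feldman, Svensson and Zenklusen for known \<open>x\<close>, we want a chain
  \<open>U = N\<^sub>0 \<supseteq> N\<^sub>1 \<supseteq> \<dots>\<close> such that an element \<open>i\<close> lost from \<open>N = N\<^sub>j\<close> to \<open>S = N\<^sub>j\<^sub>+\<^sub>1\<close> is spanned by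
  \<open>(Q - i) \<inter> N \<union> S\<close> with probability at most about \<open>1/2\<close>: processing each \<open>N - S\<close> in the contraction
  by \<open>S\<close> then accepts an active \<open>i\<close> with probability about \<open>1/4\<close> at least.

  The set \<open>S\<close> is grown from \<open>{}\<close> in rounds; each round uses fresh samples to estimate all span
  probabilities and adds all elements whose estimate exceeds the threshold. Instead of running to
  stability, which may take \<open>n\<close> rounds, the growth stops after a uniformly random number of fewer than
  \<open>L\<close> rounds: an element of too large span probability that is still outside \<open>S\<close> would be added in the
  next round, and this happens to it only once, so it is left out with probability about \<open>1/L\<close>.
  However early the growth stops, comparing the expected ranks of \<open>Q \<inter> N\<close> and \<open>Q \<inter> N \<union> S\<close> gives
  \<open>rank S \<le> (1 - \<delta>) rank N\<close>. Hence \<open>O(log n)\<close> layers exhaust the matroid, \<open>L = O(log n)\<close> makes the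
  total failure probability small, and with \<open>O(log n)\<close> samples per round even \<open>O((log n)\<^sup>3)\<close> samples
  suffice.
\<close>

subsection \<open>Concentration for independent samples\<close>

lemma prob_bind_pmf:
  "measure_pmf.prob (bind_pmf p f) A = measure_pmf.expectation p (\<lambda>x. measure_pmf.prob (f x) A)"
proof -
  have "ennreal (measure_pmf.prob (bind_pmf p f) A) = (\<integral>\<^sup>+x. ennreal (measure_pmf.prob (f x) A) \<partial>p)"
    by (simp flip: measure_pmf.emeasure_eq_measure)
  also have "\<dots> = ennreal (measure_pmf.expectation p (\<lambda>x. measure_pmf.prob (f x) A))"
    by (intro nn_integral_eq_integral measure_pmf.integrable_const_bound[where B = 1]) auto
  finally show ?thesis
    by (simp add: integral_nonneg_AE)
qed

lemma integrable_pmf_bounded: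
  fixes f :: "'a \<Rightarrow> real"
  shows "(\<And>x. \<bar>f x\<bar> \<le> b) \<Longrightarrow> integrable (measure_pmf p) f"
  by (intro measure_pmf.integrable_const_bound[where B = b]) auto

text \<open>\<open>B\<close> collects bad outcomes of the first draw: on them the inner probability
  is bounded by 1, elsewhere by \<open>c\<close>. Peeling off a first round or a first layer in this
  way gives the union bounds over rounds and layers.\<close>

lemma prob_bind_pmf_le:
  assumes "\<And>x. x \<in> set_pmf p \<Longrightarrow> x \<notin> B \<Longrightarrow> measure_pmf.prob (f x) A \<le> c" "c \<ge> 0"
  shows "measure_pmf.prob (bind_pmf p f) A \<le> measure_pmf.prob p B + c"
proof -
  have "measure_pmf.expectation p (\<lambda>x. measure_pmf.prob (f x) A)
      \<le> measure_pmf.expectation p (\<lambda>x. indicator B x + c)"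
  proof (rule integral_mono_AE)
    show "integrable p (\<lambda>x. measure_pmf.prob (f x) A)"
      by (intro measure_pmf.integrable_const_bound[where B = 1]) auto
    show "AE x in p. measure_pmf.prob (f x) A \<le> indicator B x + c"
      using assms by (auto simp: AE_measure_pmf_iff indicator_def intro: add_increasing2)
  qed (use \<open>c \<ge> 0\<close> in \<open>auto intro: integrable_pmf_bounded[where b = "1 + c"] simp: indicator_def\<close>)
  also have "\<dots> = measure_pmf.prob p B + c"
    by (subst Bochner_Integration.integral_add)
      (auto intro: integrable_pmf_bounded[where b = 1] simp: indicator_def)
  finally show ?thesis by (simp add: prob_bind_pmf)
qed

lemma prob_bind_pmf_ge:
  assumes "\<And>x. x \<in> set_pmf p \<Longrightarrow> x \<in> B \<Longrightarrow> measure_pmf.prob (f x) A \<ge> c"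
  shows "measure_pmf.prob (bind_pmf p f) A \<ge> measure_pmf.prob p B * c"
proof -
  have "measure_pmf.prob p B * c = measure_pmf.expectation p (\<lambda>x. indicator B x * c)"
    by simp
  also have "\<dots> \<le> measure_pmf.expectation p (\<lambda>x. measure_pmf.prob (f x) A)"
  proof (rule integral_mono_AE)
    show "integrable p (\<lambda>x. measure_pmf.prob (f x) A)"
      by (intro measure_pmf.integrable_const_bound[where B = 1]) auto
    show "AE x in p. indicator B x * c \<le> measure_pmf.prob (f x) A"
      using assms by (auto simp: AE_measure_pmf_iff indicator_def)
  qed (auto intro!: integrable_pmf_bounded[where b = "1 + \<bar>c\<bar>"] simp: indicator_def)
  finally show ?thesis by (simp add: prob_bind_pmf)
qed

text \<open>Independence turns the exponential moment of a sum into a product. Nonnegative integrals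
  avoid integrability conditions for functions on lists.\<close>

lemma nn_integral_exp_replicate_pmf_le:
  fixes f :: "'a \<Rightarrow> real" and p :: "'a pmf"
  assumes "(\<integral>\<^sup>+x. ennreal (exp (f x)) \<partial>p) \<le> ennreal c" "c \<ge> 0"
  shows "(\<integral>\<^sup>+xs. ennreal (exp (sum_list (map f xs))) \<partial>replicate_pmf m p) \<le> ennreal (c ^ m)"
proof (induction m)
  case (Suc m)
  have "(\<integral>\<^sup>+xs. ennreal (exp (sum_list (map f xs))) \<partial>replicate_pmf (Suc m) p)
      = (\<integral>\<^sup>+x. ennreal (exp (f x)) * (\<integral>\<^sup>+xs. ennreal (exp (sum_list (map f xs))) \<partial>replicate_pmf m p) \<partial>p)"
    by (simp add: exp_add ennreal_mult nn_integral_cmult)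
  also have "\<dots> \<le> (\<integral>\<^sup>+x. ennreal (exp (f x)) * ennreal (c ^ m) \<partial>p)"
    by (intro nn_integral_mono mult_left_mono Suc.IH) auto
  also have "\<dots> = (\<integral>\<^sup>+x. ennreal (exp (f x)) \<partial>p) * ennreal (c ^ m)"
    by (rule nn_integral_multc) auto
  also have "\<dots> \<le> ennreal c * ennreal (c ^ m)"
    by (intro mult_right_mono assms) auto
  finally show ?case using \<open>c \<ge> 0\<close> by (simp add: ennreal_mult)
qed auto

text \<open>Exponential Markov inequality; the exponential moment of one sample is bounded through
  \<open>exp y <= 1 + y + y^2\<close> on the unit interval.\<close>

lemma chernoff_replicate_pmf_ge:
  fixes f :: "'a \<Rightarrow> real" and p :: "'a pmf"
  assumes "\<And>x. f x \<in> {0..1}" "0 < d" "d \<le> 1"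
  shows "measure_pmf.prob (replicate_pmf m p)
      {xs. sum_list (map f xs) \<ge> real m * (measure_pmf.expectation p f + d)} \<le> exp (- real m * d\<^sup>2 / 4)"
proof -
  define \<mu> where "\<mu> = measure_pmf.expectation p f"
  \<comment> \<open>This minimises the exponent \<open>l^2 - l * d\<close> left per sample; its
    value is \<open>- d^2 / 4\<close>.\<close>
  define l where "l = d / 2"
  have l: "0 < l" "l \<le> 1" using assms by (auto simp: l_def)
  have int: "integrable p f"
    using assms(1) by (intro measure_pmf.integrable_const_bound[where B = 1]) auto
  have "measure_pmf.expectation p (\<lambda>x. exp (l * f x)) \<le> measure_pmf.expectation p (\<lambda>x. 1 + l * f x + l\<^sup>2)"
  proof (rule integral_mono)
    show "integrable p (\<lambda>x. exp (l * f x))"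
      using assms(1) l by (intro measure_pmf.integrable_const_bound[where B = "exp 1"])
        (auto simp: mult_le_one)
    show "exp (l * f x) \<le> 1 + l * f x + l\<^sup>2" for x
    proof -
      have f: "0 \<le> f x" "f x \<le> 1" using assms(1)[of x] by auto
      have "exp (l * f x) \<le> 1 + l * f x + (l * f x)\<^sup>2"
        using f l by (intro exp_bound) (auto simp: mult_le_one)
      also have "(l * f x)\<^sup>2 \<le> l\<^sup>2"
        using f l by (intro power_mono) (auto simp: mult_left_le)
      finally show ?thesis by simp
    qed
  qed (use int in auto)
  also have "\<dots> = 1 + (l * \<mu> + l\<^sup>2)"
    using int by (simp add: \<mu>_def)
  also have "\<dots> \<le> exp (l * \<mu> + l\<^sup>2)" by (rule exp_ge_add_one_self)
  finally have *: "measure_pmf.expectation p (\<lambda>x. exp (l * f x)) \<le> exp (l * \<mu> + l\<^sup>2)" .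
  have "(\<integral>\<^sup>+x. ennreal (exp (l * f x)) \<partial>p) = ennreal (measure_pmf.expectation p (\<lambda>x. exp (l * f x)))"
    using assms(1) l by (intro nn_integral_eq_integral measure_pmf.integrable_const_bound[where B = "exp 1"])
      (auto simp: mult_le_one)
  also have "\<dots> \<le> ennreal (exp (l * \<mu> + l\<^sup>2))" using * by (rule ennreal_leI)
  finally have mgf: "(\<integral>\<^sup>+xs. ennreal (exp (sum_list (map (\<lambda>x. l * f x) xs))) \<partial>replicate_pmf m p)
      \<le> ennreal (exp (l * \<mu> + l\<^sup>2) ^ m)"
    by (rule nn_integral_exp_replicate_pmf_le) simp
  define t where "t = real m * (\<mu> + d)"
  have "emeasure (replicate_pmf m p) {xs. sum_list (map f xs) \<ge> t}
      \<le> emeasure (replicate_pmf m p)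
          {xs \<in> space (replicate_pmf m p). 1 \<le> ennreal (exp (- l * t)) * ennreal (exp (sum_list (map (\<lambda>x. l * f x) xs)))}"
  proof (rule emeasure_mono)
    show "{xs. sum_list (map f xs) \<ge> t} \<subseteq> {xs \<in> space (replicate_pmf m p).
        1 \<le> ennreal (exp (- l * t)) * ennreal (exp (sum_list (map (\<lambda>x. l * f x) xs)))}"
      using l by (auto simp flip: ennreal_mult exp_add simp: sum_list_const_mult)
  qed auto
  also have "\<dots> \<le> ennreal (exp (- l * t)) * (\<integral>\<^sup>+xs. ennreal (exp (sum_list (map (\<lambda>x. l * f x) xs))) \<partial>replicate_pmf m p)"
    using nn_integral_Markov_inequality[of _ UNIV "replicate_pmf m p"] by simp
  also have "\<dots> \<le> ennreal (exp (- l * t)) * ennreal (exp (l * \<mu> + l\<^sup>2) ^ m)"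
    by (intro mult_left_mono mgf) auto
  also have "\<dots> = ennreal (exp (- l * t) * exp (real m * (l * \<mu> + l\<^sup>2)))"
    by (simp add: ennreal_mult exp_of_nat_mult)
  also have "exp (- l * t) * exp (real m * (l * \<mu> + l\<^sup>2)) = exp (- real m * d\<^sup>2 / 4)"
    unfolding exp_add[symmetric] by (rule arg_cong[where f = exp]) (simp add: t_def l_def power2_eq_square field_simps)
  finally show ?thesis
    by (simp add: measure_pmf.emeasure_eq_measure t_def \<mu>_def)
qed

text \<open>The upper tail bound applied to \<open>1 - f\<close>. The two events are compared on the
  support only, where lists have length \<open>m\<close>.\<close>

lemma chernoff_replicate_pmf_le:
  fixes f :: "'a \<Rightarrow> real" and p :: "'a pmf"
  assumes "\<And>x. f x \<in> {0..1}" "0 < d" "d \<le> 1"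
  shows "measure_pmf.prob (replicate_pmf m p)
      {xs. sum_list (map f xs) \<le> real m * (measure_pmf.expectation p f - d)} \<le> exp (- real m * d\<^sup>2 / 4)"
proof -
  have int: "integrable p f"
    using assms(1) by (intro measure_pmf.integrable_const_bound[where B = 1]) auto
  have "measure_pmf.prob (replicate_pmf m p) {xs. sum_list (map f xs) \<le> real m * (measure_pmf.expectation p f - d)}
      \<le> measure_pmf.prob (replicate_pmf m p)
      {xs. sum_list (map (\<lambda>x. 1 - f x) xs) \<ge> real m * (measure_pmf.expectation p (\<lambda>x. 1 - f x) + d)}"
  proof (rule measure_pmf.finite_measure_mono_AE)
    show "AE xs in replicate_pmf m p. xs \<in> {xs. sum_list (map f xs) \<le> real m * (measure_pmf.expectation p f - d)} \<longrightarrow>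
      xs \<in> {xs. sum_list (map (\<lambda>x. 1 - f x) xs) \<ge> real m * (measure_pmf.expectation p (\<lambda>x. 1 - f x) + d)}"
      using int by (auto simp: AE_measure_pmf_iff set_replicate_pmf sum_list_subtractf sum_list_triv algebra_simps)
  qed auto
  also have "\<dots> \<le> exp (- real m * d\<^sup>2 / 4)"
    using assms by (intro chernoff_replicate_pmf_ge) auto
  finally show ?thesis .
qed

subsection \<open>Span and rank\<close>

text \<open>The usual closure, phrased through a dependent extension instead of the rank, which
  makes monotonicity and \<open>indep_insert\<close> immediate. In a matroid, elements outside the
  ground set lie in every span.\<close>

definition matroid_span :: "'a set set \<Rightarrow> 'a set \<Rightarrow> 'a set" where
  "matroid_span \<I> X = X \<union> {e. \<exists>I\<in>\<I>. I \<subseteq> X \<and> insert e I \<notin> \<I>}"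

lemma matroid_span_mono: "X \<subseteq> Y \<Longrightarrow> matroid_span \<I> X \<subseteq> matroid_span \<I> Y"
  unfolding matroid_span_def by blast

lemma matroid_span_superset: "X \<subseteq> matroid_span \<I> X"
  unfolding matroid_span_def by blast

context matroid
begin

lemma indep_insert: "I \<in> \<I> \<Longrightarrow> I \<subseteq> X \<Longrightarrow> e \<notin> matroid_span \<I> X \<Longrightarrow> insert e I \<in> \<I>"
  unfolding matroid_span_def by blast

lemma finite_indep_sets: "finite \<I>"
  using finite_ground indep_subset_ground by (auto intro: finite_subset[of _ "Pow U"])

lemma finite_indep: "I \<in> \<I> \<Longrightarrow> finite I"
  using finite_ground indep_subset_ground finite_subset by blast

lemma card_indep_le_rank: "I \<in> \<I> \<Longrightarrow> I \<subseteq> X \<Longrightarrow> card I \<le> matroid_rank \<I> X"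
  unfolding matroid_rank_def using finite_indep_sets by (intro Max_ge) auto

lemma basis_exists:
  obtains B where "B \<in> \<I>" "B \<subseteq> X" "card B = matroid_rank \<I> X"
proof -
  have "matroid_rank \<I> X \<in> card ` {T \<in> \<I>. T \<subseteq> X}"
    unfolding matroid_rank_def using finite_indep_sets indep_empty by (intro Max_in) auto
  then show ?thesis using that by auto
qed

lemma rank_mono: "X \<subseteq> Y \<Longrightarrow> matroid_rank \<I> X \<le> matroid_rank \<I> Y"
  by (rule basis_exists[of X], rule basis_exists[of Y]) (metis card_indep_le_rank order_trans)

lemma rank_le_card: "finite X \<Longrightarrow> matroid_rank \<I> X \<le> card X"
  by (rule basis_exists[of X]) (metis card_mono)

lemma rank_empty [simp]: "matroid_rank \<I> {} = 0"
  using rank_le_card[of "{}"] by simp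

lemma rank_insert_le: "matroid_rank \<I> (insert e X) \<le> Suc (matroid_rank \<I> X)"
proof -
  obtain B where B: "B \<in> \<I>" "B \<subseteq> insert e X" "card B = matroid_rank \<I> (insert e X)"
    by (rule basis_exists)
  have "card (B - {e}) \<le> matroid_rank \<I> X"
    using B indep_mono[of B "B - {e}"] by (intro card_indep_le_rank) auto
  then show ?thesis
    using B(3) finite_indep[OF B(1)] by (cases "e \<in> B") (auto simp: card_Diff_singleton)
qed

text \<open>Take a largest independent \<open>B\<close> between the witness \<open>I\<close> and
  \<open>X\<close>. Were a basis of \<open>insert e X\<close> larger, augmenting \<open>B\<close>
  from it would either add \<open>e\<close>, making \<open>insert e I\<close> independent, or add an
  element of \<open>X\<close>, contradicting maximality.\<close>

lemma rank_insert_span: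
  assumes "e \<in> matroid_span \<I> X"
  shows "matroid_rank \<I> (insert e X) = matroid_rank \<I> X"
proof (cases "e \<in> X")
  case False
  then obtain I where I: "I \<in> \<I>" "I \<subseteq> X" "insert e I \<notin> \<I>"
    using assms by (auto simp: matroid_span_def)
  obtain T where T: "T \<in> \<I>" "T \<subseteq> insert e X" "card T = matroid_rank \<I> (insert e X)"
    by (rule basis_exists)
  define F where "F = {B \<in> \<I>. I \<subseteq> B \<and> B \<subseteq> X}"
  have "finite F" "I \<in> F" using I finite_indep_sets by (auto simp: F_def)
  then have "Max (card ` F) \<in> card ` F" "\<And>B. B \<in> F \<Longrightarrow> card B \<le> Max (card ` F)"
    by (auto intro: Max_in)
  then obtain B where B: "B \<in> F" "\<And>B'. B' \<in> F \<Longrightarrow> card B' \<le> card B"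
    by force
  have BI: "B \<in> \<I>" "I \<subseteq> B" "B \<subseteq> X" using B(1) by (simp_all add: F_def)
  have "\<not> card B < card T"
  proof
    assume "card B < card T"
    then obtain y where y: "y \<in> T - B" "insert y B \<in> \<I>"
      using indep_augment[of B T] BI T(1) by blast
    show False
    proof (cases "y = e")
      case True
      then have "insert e I \<in> \<I>" using y BI indep_mono[of "insert y B" "insert e I"] by blast
      then show False using I by simp
    next
      case False
      then have "insert y B \<in> F" using y T(2) BI by (auto simp: F_def)
      then show False using B(2)[of "insert y B"] y(1) finite_indep[OF BI(1)] by simp
    qed
  qed
  then have "matroid_rank \<I> (insert e X) \<le> matroid_rank \<I> X"
    using T(3) card_indep_le_rank[OF BI(1,3)] by simp
  then show ?thesis using rank_mono[OF subset_insertI, of X e] by (rule antisym)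
qed (simp add: insert_absorb)

lemma rank_insert_not_span:
  assumes "e \<notin> matroid_span \<I> X"
  shows "matroid_rank \<I> (insert e X) = Suc (matroid_rank \<I> X)"
proof -
  obtain B where B: "B \<in> \<I>" "B \<subseteq> X" "card B = matroid_rank \<I> X" by (rule basis_exists)
  have "e \<notin> B" using assms B(2) matroid_span_superset[of X \<I>] by blast
  moreover have "insert e B \<in> \<I>" using B(1,2) assms by (rule indep_insert)
  ultimately show ?thesis
    using B card_indep_le_rank[of "insert e B" "insert e X"] rank_insert_le[of e X] finite_indep[OF B(1)]
    by (simp add: insert_mono subset_insertI2)
qed

lemma rank_insert:
  "matroid_rank \<I> (insert e X) = matroid_rank \<I> X + of_bool (e \<notin> matroid_span \<I> X)"
  using rank_insert_span rank_insert_not_span by simp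

text \<open>
  Adding \<open>e\<close> to \<open>S\<close> raises the expected rank of \<open>Q \<union> S\<close> by at most \<open>1 - \<alpha>\<close>, and not at all unless it
  raises the rank of \<open>S\<close>.
\<close>

lemma expected_rank_Un_le:
  fixes q :: "'a set pmf"
  assumes "finite (set_pmf q)" "finite D"
    and "\<And>e. e \<in> D \<Longrightarrow> measure_pmf.prob q {Q. e \<in> matroid_span \<I> (Q \<union> S)} \<ge> \<alpha>"
    and "measure_pmf.expectation q (\<lambda>Q. real (matroid_rank \<I> (Q \<union> S)))
           \<le> C + (1 - \<alpha>) * real (matroid_rank \<I> S)"
  shows "measure_pmf.expectation q (\<lambda>Q. real (matroid_rank \<I> (Q \<union> (S \<union> D))))
           \<le> C + (1 - \<alpha>) * real (matroid_rank \<I> (S \<union> D))"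
  using assms(2,3)
proof (induction D)
  case empty
  then show ?case using assms by simp
next
  case (insert e D)
  let ?T = "S \<union> D"
  have int: "integrable q f" for f :: "'a set \<Rightarrow> real"
    using assms(1) by (rule integrable_measure_pmf_finite)
  let ?E = "{Q. e \<in> matroid_span \<I> (Q \<union> ?T)}"
  have "measure_pmf.expectation q (\<lambda>Q. real (matroid_rank \<I> (Q \<union> (S \<union> insert e D))))
      = measure_pmf.expectation q (\<lambda>Q. real (matroid_rank \<I> (Q \<union> ?T)) + (1 - indicator ?E Q))"
    by (intro Bochner_Integration.integral_cong) (simp_all add: rank_insert indicator_def)
  also have "\<dots> = measure_pmf.expectation q (\<lambda>Q. real (matroid_rank \<I> (Q \<union> ?T)))
      + (1 - measure_pmf.prob q ?E)"
    using int by (simp add: Bochner_Integration.integral_add)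
  also have "measure_pmf.expectation q (\<lambda>Q. real (matroid_rank \<I> (Q \<union> ?T)))
      \<le> C + (1 - \<alpha>) * real (matroid_rank \<I> ?T)"
    using insert by auto
  \<comment> \<open>If \<open>?T\<close> spans \<open>e\<close>, so does every superset, and no rank
    grows. Otherwise the bound assumed for \<open>S\<close> carries over to the larger set
    \<open>?T\<close>.\<close>
  also have "1 - measure_pmf.prob q ?E \<le> (1 - \<alpha>) * of_bool (e \<notin> matroid_span \<I> ?T)"
  proof (cases "e \<in> matroid_span \<I> ?T")
    case True
    then have "?E = UNIV"
      using matroid_span_mono[of ?T "Q \<union> ?T" \<I> for Q] by blast
    then show ?thesis using True by simp
  next
    case False
    have "\<alpha> \<le> measure_pmf.prob q {Q. e \<in> matroid_span \<I> (Q \<union> S)}" using insert.prems by auto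
    also have "\<dots> \<le> measure_pmf.prob q ?E"
    proof (rule measure_pmf.finite_measure_mono)
      have "matroid_span \<I> (Q \<union> S) \<subseteq> matroid_span \<I> (Q \<union> ?T)" for Q
        by (rule matroid_span_mono) blast
      then show "{Q. e \<in> matroid_span \<I> (Q \<union> S)} \<subseteq> ?E" by blast
    qed simp
    finally show ?thesis using False by simp
  qed
  finally show ?case
    using rank_insert[of e ?T] by (simp add: algebra_simps)
qed

end

subsection \<open>Random active sets\<close>

lemma active_pmf_subset: "finite U \<Longrightarrow> Q \<in> set_pmf (active_pmf U x) \<Longrightarrow> Q \<subseteq> U"
  using set_Pi_pmf_subset[of U False] by (fastforce simp: active_pmf_def)

lemma finite_set_active_pmf: "finite U \<Longrightarrow> finite (set_pmf (active_pmf U x))"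
  by (rule finite_subset[of _ "Pow U"]) (auto dest: active_pmf_subset)

lemma active_pmf_insert:
  assumes "finite U" "i \<notin> U"
  shows "active_pmf (insert i U) x =
    do {b \<leftarrow> bernoulli_pmf (x i); Q \<leftarrow> active_pmf U x; return_pmf (if b then insert i Q else Q)}"
proof -
  have *: "{j. (f(i := b)) j} = (if b then insert i {j. f j} else {j. f j})"
    if "f \<in> set_pmf (Pi_pmf U False (\<lambda>i. bernoulli_pmf (x i)))" for f b
    using set_Pi_pmf_subset[of U False] that assms by auto
  show ?thesis
    using assms
    by (auto simp: active_pmf_def Pi_pmf_insert' map_bind_pmf bind_map_pmf * intro!: bind_pmf_cong)
qed

lemma bernoulli_pmf_conj:
  assumes "a \<in> {0..1}" "b \<in> {0..1}"
  shows "do {u \<leftarrow> bernoulli_pmf a; v \<leftarrow> bernoulli_pmf b; return_pmf (u \<and> v)} = bernoulli_pmf (a * b)"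
proof (rule pmf_eqI)
  fix w
  have "a * b \<in> {0..1}" using assms by (auto intro: mult_le_one)
  then show "pmf (do {u \<leftarrow> bernoulli_pmf a; v \<leftarrow> bernoulli_pmf b; return_pmf (u \<and> v)}) w
      = pmf (bernoulli_pmf (a * b)) w"
    using assms by (cases w) (simp_all add: pmf_bind measure_pmf_single algebra_simps)
qed

text \<open>Thinning acts on each element separately, where the conjunction of two independent coins
  has the product probability. The induction commutes draws until the two coins of \<open>i\<close>
  are adjacent.\<close>

lemma active_pmf_Int:
  assumes "finite U" "\<And>i. i \<in> U \<Longrightarrow> x i \<in> {0..1}" "\<And>i. i \<in> U \<Longrightarrow> y i \<in> {0..1}"
  shows "do {R \<leftarrow> active_pmf U x; M \<leftarrow> active_pmf U y; return_pmf (R \<inter> M)} = active_pmf U (\<lambda>i. x i * y i)"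
  using assms
proof (induction U)
  case empty
  then show ?case by (simp add: active_pmf_def bind_return_pmf)
next
  case (insert i U)
  let ?X = "active_pmf U x" and ?Y = "active_pmf U y"
  have notin: "i \<notin> Q" if "Q \<in> set_pmf (active_pmf U z)" for Q z
    using insert.hyps active_pmf_subset that by blast
  have "do {R \<leftarrow> active_pmf (insert i U) x; M \<leftarrow> active_pmf (insert i U) y; return_pmf (R \<inter> M)}
     = do {u \<leftarrow> bernoulli_pmf (x i); R \<leftarrow> ?X; v \<leftarrow> bernoulli_pmf (y i); M \<leftarrow> ?Y;
         return_pmf ((if u then insert i R else R) \<inter> (if v then insert i M else M))}"
    using insert.hyps by (simp add: active_pmf_insert bind_assoc_pmf bind_return_pmf)
  also have "\<dots> = do {u \<leftarrow> bernoulli_pmf (x i); v \<leftarrow> bernoulli_pmf (y i); R \<leftarrow> ?X; M \<leftarrow> ?Y;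
         return_pmf ((if u then insert i R else R) \<inter> (if v then insert i M else M))}"
    by (intro bind_pmf_cong refl) (rule bind_commute_pmf)
  also have "\<dots> = do {u \<leftarrow> bernoulli_pmf (x i); v \<leftarrow> bernoulli_pmf (y i); R \<leftarrow> ?X; M \<leftarrow> ?Y;
         return_pmf (if u \<and> v then insert i (R \<inter> M) else R \<inter> M)}"
    using notin by (intro bind_pmf_cong refl) auto
  also have "\<dots> = do {w \<leftarrow> do {u \<leftarrow> bernoulli_pmf (x i); v \<leftarrow> bernoulli_pmf (y i); return_pmf (u \<and> v)};
         Q \<leftarrow> do {R \<leftarrow> ?X; M \<leftarrow> ?Y; return_pmf (R \<inter> M)}; return_pmf (if w then insert i Q else Q)}"
    by (simp add: bind_assoc_pmf bind_return_pmf)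
  also have "\<dots> = active_pmf (insert i U) (\<lambda>i. x i * y i)"
    using insert by (simp add: active_pmf_insert bernoulli_pmf_conj)
  finally show ?case .
qed

text \<open>The coin of \<open>i\<close> is independent of \<open>Q - {i}\<close>, and
  \<open>P\<close> looks at nothing else. To exploit this, the span probabilities below ignore the
  activity of \<open>i\<close> itself.\<close>

lemma prob_active_pmf_mem_and:
  assumes "finite U" "i \<in> U" "x i \<in> {0..1}"
  shows "measure_pmf.prob (active_pmf U x) {Q. i \<in> Q \<and> P (Q - {i})}
    = x i * measure_pmf.prob (active_pmf U x) {Q. P (Q - {i})}"
proof -
  let ?q = "active_pmf (U - {i}) x"
  have U: "active_pmf U x =
    do {b \<leftarrow> bernoulli_pmf (x i); Q \<leftarrow> ?q; return_pmf (if b then insert i Q else Q)}"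
    using active_pmf_insert[of "U - {i}" i x] assms by (simp add: insert_absorb)
  have Q: "i \<notin> Q" if "Q \<in> set_pmf ?q" for Q
    using that assms active_pmf_subset[of "U - {i}" Q x] by auto
  have *: "measure_pmf.prob (do {Q \<leftarrow> ?q; return_pmf (if b then insert i Q else Q)}) {Q. P (Q - {i})}
    = measure_pmf.prob ?q {Q. P Q}" for b
    unfolding map_pmf_def[symmetric] measure_map_pmf
    by (rule measure_pmf.finite_measure_eq_AE) (use Q in \<open>auto simp: AE_measure_pmf_iff\<close>)
  have **: "measure_pmf.prob (do {Q \<leftarrow> ?q; return_pmf (if b then insert i Q else Q)}) {Q. i \<in> Q \<and> P (Q - {i})}
    = of_bool b * measure_pmf.prob ?q {Q. P Q}" for b
  proof -
    have "measure_pmf.prob ?q ((\<lambda>Q. if b then insert i Q else Q) -` {Q. i \<in> Q \<and> P (Q - {i})})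
      = measure_pmf.prob ?q (if b then {Q. P Q} else {})"
      by (rule measure_pmf.finite_measure_eq_AE) (use Q in \<open>auto simp: AE_measure_pmf_iff\<close>)
    then show ?thesis unfolding map_pmf_def[symmetric] measure_map_pmf by simp
  qed
  show ?thesis
    unfolding U prob_bind_pmf[of "bernoulli_pmf (x i)"] * ** using assms(3) by simp
qed

lemma prob_active_pmf_mem:
  assumes "finite U" "i \<in> U" "x i \<in> {0..1}"
  shows "measure_pmf.prob (active_pmf U x) {Q. i \<in> Q} = x i"
  using assms prob_active_pmf_mem_and[of U i x "\<lambda>_. True"] by simp

lemma expectation_card_active_pmf:
  assumes "finite U" "N \<subseteq> U" "\<And>i. i \<in> U \<Longrightarrow> x i \<in> {0..1}"
  shows "measure_pmf.expectation (active_pmf U x) (\<lambda>Q. real (card (Q \<inter> N))) = (\<Sum>i\<in>N. x i)"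
proof -
  have N: "finite N" using assms finite_subset by blast
  have "real (card (Q \<inter> N)) = (\<Sum>i\<in>N. indicator {Q. i \<in> Q} Q)" for Q :: "'a set"
    using N by (simp add: indicator_def Int_def conj_commute flip: sum.inter_filter)
  then have "measure_pmf.expectation (active_pmf U x) (\<lambda>Q. real (card (Q \<inter> N)))
    = (\<Sum>i\<in>N. measure_pmf.prob (active_pmf U x) {Q. i \<in> Q})"
    using assms(1) by (simp add: Bochner_Integration.integral_sum integrable_measure_pmf_finite finite_set_active_pmf)
  also have "\<dots> = (\<Sum>i\<in>N. x i)"
    using assms by (intro sum.cong refl prob_active_pmf_mem) auto
  finally show ?thesis .
qed

subsection \<open>Growing the next layer\<close>

definition span_prob :: "'a set set \<Rightarrow> 'a set pmf \<Rightarrow> 'a set \<Rightarrow> 'a set \<Rightarrow> 'a \<Rightarrow> real" where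
  "span_prob \<I> q N S i = measure_pmf.prob q {Q. i \<in> matroid_span \<I> ((Q - {i}) \<inter> N \<union> S)}"

text \<open>The law of the masked active set given the active set \<open>R\<close>. Averaging over
  masks exactly, one sample contributes a number in the unit interval whose mean is the true span
  probability (\<open>expectation_span_prob\<close>).\<close>

definition half_thinned :: "'a set \<Rightarrow> 'a set \<Rightarrow> 'a set pmf" where
  "half_thinned U R = map_pmf (\<lambda>M. R \<inter> M) (active_pmf U (\<lambda>_. 1/2))"

definition absorb :: "'a set \<Rightarrow> 'a set set \<Rightarrow> real \<Rightarrow> 'a set \<Rightarrow> 'a set \<Rightarrow> 'a set list \<Rightarrow> 'a set" where
  "absorb U \<I> \<theta> N S Rs =
     S \<union> {i \<in> N. (\<Sum>R\<leftarrow>Rs. span_prob \<I> (half_thinned U R) N S i) > \<theta> * real (length Rs)}"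

lemma span_prob_bind_pmf:
  "span_prob \<I> (bind_pmf p f) N S i = measure_pmf.expectation p (\<lambda>R. span_prob \<I> (f R) N S i)"
  by (simp add: span_prob_def prob_bind_pmf)

lemma span_prob_range: "span_prob \<I> q N S i \<in> {0..1}"
  by (simp add: span_prob_def)

locale sampled_matroid = matroid U \<I> for U :: "'a set" and \<I> +
  fixes x :: "'a \<Rightarrow> real" and \<delta> :: real and m :: nat
  assumes x_polytope: "x \<in> matroid_polytope U \<I>"
    and \<delta>_pos: "\<delta> > 0" and \<delta>_le: "\<delta> \<le> 1/8"
begin

abbreviation samples :: "'a set list pmf" where
  "samples \<equiv> replicate_pmf m (active_pmf U x)"

abbreviation thinned :: "'a set pmf" where
  "thinned \<equiv> active_pmf U (\<lambda>i. x i * (1/2))"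

text \<open>Chernoff bound for the event that an estimate from \<open>m\<close> samples is off by at
  least \<open>\<delta>\<close> in a given direction.\<close>

definition \<eta> :: real where
  "\<eta> = exp (- real m * \<delta>\<^sup>2 / 4)"

text \<open>The threshold leaves a margin of \<open>\<delta>\<close> on both sides: an estimate with
  error below \<open>\<delta>\<close> never adds an element of span probability at most
  \<open>1/2 + \<delta>\<close> and never misses one above
  \<open>1/2 + 3 * \<delta>\<close>.\<close>

abbreviation extend :: "'a set \<Rightarrow> 'a set \<Rightarrow> 'a set list \<Rightarrow> 'a set" where
  "extend \<equiv> absorb U \<I> (1/2 + 2 * \<delta>)"

lemma \<eta>_nonneg: "\<eta> \<ge> 0" and \<eta>_le_1: "\<eta> \<le> 1"
  by (simp_all add: \<eta>_def)

lemma x_range: "i \<in> U \<Longrightarrow> x i \<in> {0..1}"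
  using x_polytope by (auto simp: matroid_polytope_def)

lemma half_x_range: "i \<in> U \<Longrightarrow> x i * (1/2) \<in> {0..1}"
  using x_range[of i] by auto

lemma sum_le_rank: "S \<subseteq> U \<Longrightarrow> sum x S \<le> real (matroid_rank \<I> S)"
  using x_polytope by (auto simp: matroid_polytope_def)

lemma finite_set_thinned: "finite (set_pmf thinned)"
  using finite_ground by (rule finite_set_active_pmf)

lemma bind_half_thinned: "bind_pmf (active_pmf U x) (half_thinned U) = thinned"
  unfolding half_thinned_def map_pmf_def
  using finite_ground x_range by (intro active_pmf_Int) auto

lemma expectation_span_prob:
  "measure_pmf.expectation (active_pmf U x) (\<lambda>R. span_prob \<I> (half_thinned U R) N S i)
    = span_prob \<I> thinned N S i"
  unfolding bind_half_thinned[symmetric] span_prob_bind_pmf ..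

lemma prob_overestimate:
  assumes "span_prob \<I> thinned N S i \<le> 1/2 + \<delta>"
  shows "measure_pmf.prob samples
    {Rs. (\<Sum>R\<leftarrow>Rs. span_prob \<I> (half_thinned U R) N S i) > (1/2 + 2 * \<delta>) * real m} \<le> \<eta>"
proof -
  have "measure_pmf.prob samples
      {Rs. (\<Sum>R\<leftarrow>Rs. span_prob \<I> (half_thinned U R) N S i) > (1/2 + 2 * \<delta>) * real m}
    \<le> measure_pmf.prob samples
      {Rs. (\<Sum>R\<leftarrow>Rs. span_prob \<I> (half_thinned U R) N S i) \<ge> real m * (span_prob \<I> thinned N S i + \<delta>)}"
  proof (rule measure_pmf.finite_measure_mono)
    have "real m * (span_prob \<I> thinned N S i + \<delta>) \<le> real m * (1/2 + 2 * \<delta>)"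
      using assms by (intro mult_left_mono) auto
    then show "{Rs. (\<Sum>R\<leftarrow>Rs. span_prob \<I> (half_thinned U R) N S i) > (1/2 + 2 * \<delta>) * real m}
      \<subseteq> {Rs. (\<Sum>R\<leftarrow>Rs. span_prob \<I> (half_thinned U R) N S i) \<ge> real m * (span_prob \<I> thinned N S i + \<delta>)}"
      by (auto simp: mult.commute)
  qed simp
  also have "\<dots> \<le> \<eta>"
    unfolding expectation_span_prob[symmetric] \<eta>_def
    using \<delta>_pos \<delta>_le by (intro chernoff_replicate_pmf_ge span_prob_range) auto
  finally show ?thesis .
qed

lemma prob_underestimate:
  assumes "span_prob \<I> thinned N S i > 1/2 + 3 * \<delta>"
  shows "measure_pmf.prob samples
    {Rs. (\<Sum>R\<leftarrow>Rs. span_prob \<I> (half_thinned U R) N S i) \<le> (1/2 + 2 * \<delta>) * real m} \<le> \<eta>"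
proof -
  have "measure_pmf.prob samples
      {Rs. (\<Sum>R\<leftarrow>Rs. span_prob \<I> (half_thinned U R) N S i) \<le> (1/2 + 2 * \<delta>) * real m}
    \<le> measure_pmf.prob samples
      {Rs. (\<Sum>R\<leftarrow>Rs. span_prob \<I> (half_thinned U R) N S i) \<le> real m * (span_prob \<I> thinned N S i - \<delta>)}"
  proof (rule measure_pmf.finite_measure_mono)
    have "real m * (1/2 + 2 * \<delta>) \<le> real m * (span_prob \<I> thinned N S i - \<delta>)"
      using assms by (intro mult_left_mono) auto
    then show "{Rs. (\<Sum>R\<leftarrow>Rs. span_prob \<I> (half_thinned U R) N S i) \<le> (1/2 + 2 * \<delta>) * real m}
      \<subseteq> {Rs. (\<Sum>R\<leftarrow>Rs. span_prob \<I> (half_thinned U R) N S i) \<le> real m * (span_prob \<I> thinned N S i - \<delta>)}"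
      by (auto simp: mult.commute)
  qed simp
  also have "\<dots> \<le> \<eta>"
    unfolding expectation_span_prob[symmetric] \<eta>_def
    using \<delta>_pos \<delta>_le by (intro chernoff_replicate_pmf_le span_prob_range) auto
  finally show ?thesis .
qed

section \<open>Decrease of the rank from one layer to the next\<close>

text \<open>Invariant of the growth. Adding an element of span probability at least
  \<open>1/2 + \<delta>\<close> raises the expected rank on the left by at most
  \<open>1/2 - \<delta>\<close> times the gain in the rank of \<open>S\<close>. The growth may stop
  after any round at which the invariant holds.\<close>

definition well_absorbed :: "'a set \<Rightarrow> 'a set \<Rightarrow> bool" where
  "well_absorbed N S \<longleftrightarrow> S \<subseteq> N \<and>
     measure_pmf.expectation thinned (\<lambda>Q. real (matroid_rank \<I> (Q \<inter> N \<union> S)))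
     \<le> measure_pmf.expectation thinned (\<lambda>Q. real (matroid_rank \<I> (Q \<inter> N)))
        + (1/2 - \<delta>) * real (matroid_rank \<I> S)"

lemma well_absorbed_empty: "well_absorbed N {}"
  by (simp add: well_absorbed_def)

text \<open>The left side of the invariant is at least the rank of \<open>S\<close>. The expected
  rank of \<open>Q \<inter> N\<close> is at most its expected size, half of \<open>sum x N\<close>,
  hence at most half the rank of \<open>N\<close> by the polytope constraint.\<close>

lemma well_absorbed_rank_le:
  assumes "well_absorbed N S" "N \<subseteq> U"
  shows "real (matroid_rank \<I> S) \<le> (1 - \<delta>) * real (matroid_rank \<I> N)"
proof -
  have int: "integrable thinned f" for f :: "'a set \<Rightarrow> real"
    using finite_set_thinned by (rule integrable_measure_pmf_finite)
  let ?r = "\<lambda>X. real (matroid_rank \<I> X)"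
  have fin: "finite (Q \<inter> N)" for Q using assms(2) finite_ground finite_subset by blast
  have "?r S = measure_pmf.expectation thinned (\<lambda>Q. ?r S)" by simp
  also have "\<dots> \<le> measure_pmf.expectation thinned (\<lambda>Q. ?r (Q \<inter> N \<union> S))"
    by (intro integral_mono int) (simp add: rank_mono)
  also have "\<dots> \<le> measure_pmf.expectation thinned (\<lambda>Q. ?r (Q \<inter> N)) + (1/2 - \<delta>) * ?r S"
    using assms(1) by (simp add: well_absorbed_def)
  also have "measure_pmf.expectation thinned (\<lambda>Q. ?r (Q \<inter> N))
      \<le> measure_pmf.expectation thinned (\<lambda>Q. real (card (Q \<inter> N)))"
    using fin by (intro integral_mono int) (simp add: rank_le_card)
  also have "\<dots> = sum x N / 2"
    using assms(2) finite_ground half_x_range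
    by (simp only: expectation_card_active_pmf flip: sum_distrib_right)
  also have "\<dots> \<le> ?r N / 2" using sum_le_rank[OF assms(2)] by simp
  finally have "(1 + 2 * \<delta>) * ?r S \<le> ?r N" by (simp add: algebra_simps)
  then have "(1 - \<delta>) * ((1 + 2 * \<delta>) * ?r S) \<le> (1 - \<delta>) * ?r N"
    using \<delta>_le by (intro mult_left_mono) auto
  \<comment> \<open>The product equals \<open>1 + \<delta> * (1 - 2 * \<delta>)\<close>.\<close>
  moreover have "1 * ?r S \<le> ((1 - \<delta>) * (1 + 2 * \<delta>)) * ?r S"
  proof (rule mult_right_mono)
    have "\<delta> * (2 * \<delta>) \<le> \<delta> * 1" using \<delta>_pos \<delta>_le by (intro mult_left_mono) auto
    then show "1 \<le> (1 - \<delta>) * (1 + 2 * \<delta>)" by (simp add: algebra_simps)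
  qed simp
  ultimately show ?thesis by (simp add: mult.assoc)
qed

lemma well_absorbed_extend:
  assumes "well_absorbed N S" "finite N"
    and "\<And>i. i \<in> extend N S Rs - S \<Longrightarrow> span_prob \<I> thinned N S i \<ge> 1/2 + \<delta>"
  shows "well_absorbed N (extend N S Rs)"
proof -
  let ?D = "extend N S Rs - S"
  have D: "?D \<subseteq> N" "S \<union> ?D = extend N S Rs" by (auto simp: absorb_def)
  have "measure_pmf.expectation (map_pmf (\<lambda>Q. Q \<inter> N) thinned) (\<lambda>Q. real (matroid_rank \<I> (Q \<union> (S \<union> ?D))))
     \<le> measure_pmf.expectation thinned (\<lambda>Q. real (matroid_rank \<I> (Q \<inter> N)))
       + (1 - (1/2 + \<delta>)) * real (matroid_rank \<I> (S \<union> ?D))"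
  proof (rule expected_rank_Un_le)
    show "finite (set_pmf (map_pmf (\<lambda>Q. Q \<inter> N) thinned))" using finite_set_thinned by simp
    show "finite ?D" using D(1) \<open>finite N\<close> by (rule finite_subset)
    show "measure_pmf.expectation (map_pmf (\<lambda>Q. Q \<inter> N) thinned) (\<lambda>Q. real (matroid_rank \<I> (Q \<union> S)))
      \<le> measure_pmf.expectation thinned (\<lambda>Q. real (matroid_rank \<I> (Q \<inter> N)))
       + (1 - (1/2 + \<delta>)) * real (matroid_rank \<I> S)"
      using assms(1) by (simp add: well_absorbed_def)
    fix i assume "i \<in> ?D"
    then have "1/2 + \<delta> \<le> span_prob \<I> thinned N S i" by (rule assms(3))
    \<comment> \<open>Putting \<open>i\<close> back into \<open>Q\<close> only enlarges the
      span.\<close>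
    also have "\<dots> \<le> measure_pmf.prob thinned {Q. i \<in> matroid_span \<I> (Q \<inter> N \<union> S)}"
      unfolding span_prob_def
    proof (rule measure_pmf.finite_measure_mono)
      have "matroid_span \<I> ((Q - {i}) \<inter> N \<union> S) \<subseteq> matroid_span \<I> (Q \<inter> N \<union> S)" for Q
        by (rule matroid_span_mono) blast
      then show "{Q. i \<in> matroid_span \<I> ((Q - {i}) \<inter> N \<union> S)}
          \<subseteq> {Q. i \<in> matroid_span \<I> (Q \<inter> N \<union> S)}" by blast
    qed simp
    finally show "1/2 + \<delta> \<le> measure_pmf.prob (map_pmf (\<lambda>Q. Q \<inter> N) thinned) {Q. i \<in> matroid_span \<I> (Q \<union> S)}"
      by (simp add: measure_map_pmf vimage_def)
  qed
  moreover have "extend N S Rs \<subseteq> N"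
    using assms(1) by (auto simp: absorb_def well_absorbed_def)
  ultimately show ?thesis
    using D by (simp add: well_absorbed_def)
qed

text \<open>By \<open>well_absorbed_extend\<close>, the invariant breaks only if some element of
  span probability below \<open>1/2 + \<delta>\<close> is overestimated; this is a union bound over
  such elements.\<close>

lemma prob_not_well_absorbed_extend:
  assumes "well_absorbed N S" "finite N"
  shows "measure_pmf.prob samples {Rs. \<not> well_absorbed N (extend N S Rs)} \<le> real (card N) * \<eta>"
proof -
  define B where "B i = {Rs. (\<Sum>R\<leftarrow>Rs. span_prob \<I> (half_thinned U R) N S i) > (1/2 + 2 * \<delta>) * real m}" for i
  define W where "W = {i \<in> N. span_prob \<I> thinned N S i \<le> 1/2 + \<delta>}"
  have "measure_pmf.prob samples {Rs. \<not> well_absorbed N (extend N S Rs)}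
      \<le> measure_pmf.prob samples (\<Union>i\<in>W. B i)"
  proof (rule measure_pmf.finite_measure_mono_AE)
    have "Rs \<in> (\<Union>i\<in>W. B i)"
      if len: "length Rs = m" and bad: "\<not> well_absorbed N (extend N S Rs)" for Rs
    proof -
      obtain i where "i \<in> extend N S Rs - S" "\<not> span_prob \<I> thinned N S i \<ge> 1/2 + \<delta>"
        using well_absorbed_extend[OF assms] bad by blast
      then show ?thesis using len by (auto simp: absorb_def B_def W_def)
    qed
    then show "AE Rs in samples. Rs \<in> {Rs. \<not> well_absorbed N (extend N S Rs)} \<longrightarrow> Rs \<in> (\<Union>i\<in>W. B i)"
      by (auto simp: AE_measure_pmf_iff set_replicate_pmf)
  qed simp
  also have "\<dots> \<le> (\<Sum>i\<in>W. measure_pmf.prob samples (B i))"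
    using assms(2) by (intro measure_pmf.finite_measure_subadditive_finite) (auto simp: W_def)
  also have "\<dots> \<le> (\<Sum>i\<in>W. \<eta>)"
    unfolding B_def by (intro sum_mono prob_overestimate) (simp add: W_def)
  also have "\<dots> \<le> real (card N) * \<eta>"
    using assms(2) \<eta>_nonneg by (auto simp: W_def intro!: mult_right_mono card_mono)
  finally show ?thesis .
qed

text \<open>Every round has fresh samples, so given the first block the other rounds start from a
  fixed set, and the failure bounds of the rounds add up.\<close>

lemma prob_not_well_absorbed:
  assumes "well_absorbed N S" "finite N" "T \<le> L"
  shows "measure_pmf.prob (replicate_pmf L samples) {B. \<not> well_absorbed N (foldl (extend N) S (take T B))}
    \<le> real T * (real (card N) * \<eta>)"
  using assms(1,3)
proof (induction T arbitrary: S L)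
  case (Suc T)
  then obtain L' where L: "L = Suc L'" "T \<le> L'" by (cases L) auto
  let ?P = "\<lambda>S B. \<not> well_absorbed N (foldl (extend N) S (take T B))"
  have "measure_pmf.prob (replicate_pmf L samples) {B. \<not> well_absorbed N (foldl (extend N) S (take (Suc T) B))}
    = measure_pmf.prob (do {Rs \<leftarrow> samples; map_pmf (Cons Rs) (replicate_pmf L' samples)})
        {B. \<not> well_absorbed N (foldl (extend N) S (take (Suc T) B))}"
    by (simp add: L map_pmf_def)
  also have "\<dots> \<le> measure_pmf.prob samples {Rs. \<not> well_absorbed N (extend N S Rs)} + real T * (real (card N) * \<eta>)"
    using L(2) \<eta>_nonneg by (intro prob_bind_pmf_le) (auto simp: measure_map_pmf vimage_def intro!: Suc.IH)
  also have "\<dots> \<le> real (card N) * \<eta> + real T * (real (card N) * \<eta>)"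
    using prob_not_well_absorbed_extend[OF Suc.prems(1) assms(2)] by simp
  finally show ?case by (simp add: algebra_simps)
qed simp

section \<open>Elements left out despite a high span probability\<close>

definition exposed :: "'a set \<Rightarrow> 'a \<Rightarrow> 'a set \<Rightarrow> bool" where
  "exposed N i S \<longleftrightarrow> i \<notin> S \<and> span_prob \<I> thinned N S i > 1/2 + 3 * \<delta>"

lemma foldl_extend_superset: "S \<subseteq> foldl (extend N) S B"
  by (induction B arbitrary: S) (force simp: absorb_def)+

lemma prob_exposed_not_extended:
  assumes "i \<in> N" "exposed N i S"
  shows "measure_pmf.prob samples {Rs. i \<notin> extend N S Rs} \<le> \<eta>"
proof -
  have "measure_pmf.prob samples {Rs. i \<notin> extend N S Rs} \<le> measure_pmf.prob samples
    {Rs. (\<Sum>R\<leftarrow>Rs. span_prob \<I> (half_thinned U R) N S i) \<le> (1/2 + 2 * \<delta>) * real m}"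
    using assms(1) by (intro measure_pmf.finite_measure_mono_AE)
      (auto simp: AE_measure_pmf_iff set_replicate_pmf absorb_def)
  also have "\<dots> \<le> \<eta>" using assms(2) by (intro prob_underestimate) (simp add: exposed_def)
  finally show ?thesis .
qed

text \<open>The sum is the expected number of rounds at which \<open>i\<close> is exposed. The first
  such round makes the next block add \<open>i\<close>, up to an error of probability
  \<open>\<eta>\<close>, and an element of \<open>S\<close> is never exposed again.\<close>

lemma sum_prob_exposed:
  assumes "i \<in> N"
  shows "(\<Sum>T<L. measure_pmf.prob (replicate_pmf L samples) {B. exposed N i (foldl (extend N) S (take T B))})
    \<le> (if i \<in> S then 0 else 1 + real L * \<eta>)"
proof (induction L arbitrary: S)
  case (Suc L)
  define F where "F S = (\<Sum>T<L. measure_pmf.prob (replicate_pmf L samples)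
      {B. exposed N i (foldl (extend N) S (take T B))})" for S
  have F: "F S \<le> (if i \<in> S then 0 else 1 + real L * \<eta>)" for S
    unfolding F_def by (rule Suc.IH)
  show ?case
  proof (cases "i \<in> S")
    case True
    have "\<not> exposed N i (foldl (extend N) S B)" for B
      using True foldl_extend_superset[of S N B] by (auto simp: exposed_def)
    then show ?thesis using True by simp
  next
    case False
    have "(\<Sum>T<Suc L. measure_pmf.prob (replicate_pmf (Suc L) samples) {B. exposed N i (foldl (extend N) S (take T B))})
      = of_bool (exposed N i S) + (\<Sum>T<L. measure_pmf.prob (replicate_pmf (Suc L) samples)
          {B. exposed N i (foldl (extend N) S (take (Suc T) B))})"
      \<comment> \<open>The term for \<open>T = 0\<close> concerns \<open>S\<close> itself and is
        deterministic.\<close>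
      unfolding sum.lessThan_Suc_shift by (auto simp: measure_pmf.prob_space[simplified])
    also have "(\<Sum>T<L. measure_pmf.prob (replicate_pmf (Suc L) samples)
          {B. exposed N i (foldl (extend N) S (take (Suc T) B))})
      = (\<Sum>T<L. measure_pmf.expectation samples (\<lambda>Rs. measure_pmf.prob (replicate_pmf L samples)
          {B. exposed N i (foldl (extend N) (extend N S Rs) (take T B))}))"
    proof (rule sum.cong[OF refl])
      fix T
      have "replicate_pmf (Suc L) samples = do {Rs \<leftarrow> samples; map_pmf (Cons Rs) (replicate_pmf L samples)}"
        by (simp add: map_pmf_def)
      then show "measure_pmf.prob (replicate_pmf (Suc L) samples) {B. exposed N i (foldl (extend N) S (take (Suc T) B))}
        = measure_pmf.expectation samples (\<lambda>Rs. measure_pmf.prob (replicate_pmf L samples)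
          {B. exposed N i (foldl (extend N) (extend N S Rs) (take T B))})"
        by (simp only: prob_bind_pmf) (simp add: measure_map_pmf vimage_def)
    qed
    also have "\<dots> = measure_pmf.expectation samples (\<lambda>Rs. F (extend N S Rs))"
      unfolding F_def by (subst Bochner_Integration.integral_sum)
        (auto intro!: integrable_pmf_bounded[where b = 1])
    \<comment> \<open>By induction, the later rounds contribute nothing once \<open>i\<close> has
      been added.\<close>
    also have "\<dots> \<le> measure_pmf.expectation samples
        (\<lambda>Rs. (1 + real L * \<eta>) * indicator {Rs. i \<notin> extend N S Rs} Rs)"
    proof (rule integral_mono)
      have "\<bar>F S\<bar> \<le> 1 + real L * \<eta>" for S
        using F[of S] sum_nonneg[of "{..<L}" "\<lambda>T. measure_pmf.prob (replicate_pmf L samples)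
          {B. exposed N i (foldl (extend N) S (take T B))}"]
          \<eta>_nonneg by (auto simp: F_def[symmetric] split: if_splits intro: order_trans)
      then show "integrable samples (\<lambda>Rs. F (extend N S Rs))"
        by (rule integrable_pmf_bounded)
      show "integrable samples (\<lambda>Rs. (1 + real L * \<eta>) * indicator {Rs. i \<notin> extend N S Rs} Rs)"
        using \<eta>_nonneg by (intro integrable_pmf_bounded[where b = "1 + real L * \<eta>"]) (simp add: indicator_def)
      show "F (extend N S Rs) \<le> (1 + real L * \<eta>) * indicator {Rs. i \<notin> extend N S Rs} Rs" for Rs
        using F[of "extend N S Rs"] by (simp add: indicator_def split: if_splits)
    qed
    also have "\<dots> = (1 + real L * \<eta>) * measure_pmf.prob samples {Rs. i \<notin> extend N S Rs}"
      by simp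
    finally have *: "(\<Sum>T<Suc L. measure_pmf.prob (replicate_pmf (Suc L) samples) {B. exposed N i (foldl (extend N) S (take T B))})
      \<le> of_bool (exposed N i S) + (1 + real L * \<eta>) * measure_pmf.prob samples {Rs. i \<notin> extend N S Rs}"
      by simp
    show ?thesis
    proof (cases "exposed N i S")
      case True
      \<comment> \<open>The present round costs 1, and the later ones count only if the block misses
        \<open>i\<close>.\<close>
      have "(1 + real L * \<eta>) * measure_pmf.prob samples {Rs. i \<notin> extend N S Rs} \<le> (1 + real L) * \<eta>"
        using \<eta>_nonneg \<eta>_le_1
        by (intro mult_mono prob_exposed_not_extended[OF assms True]) (auto simp: mult_left_le)
      then have "of_bool (exposed N i S) + (1 + real L * \<eta>) * measure_pmf.prob samples {Rs. i \<notin> extend N S Rs}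
        \<le> (if i \<in> S then 0 else 1 + real (Suc L) * \<eta>)"
        using True False by (simp add: add.commute)
      with * show ?thesis by (rule order_trans)
    next
      case notexp: False
      \<comment> \<open>The present round is free, so the inductive bound for the later ones
        suffices.\<close>
      have "(1 + real L * \<eta>) * measure_pmf.prob samples {Rs. i \<notin> extend N S Rs} \<le> (1 + real L * \<eta>) * 1"
        using \<eta>_nonneg by (intro mult_left_mono) auto
      also have "\<dots> \<le> 1 + real (Suc L) * \<eta>" using \<eta>_nonneg by (simp add: algebra_simps)
      finally have "of_bool (exposed N i S) + (1 + real L * \<eta>) * measure_pmf.prob samples {Rs. i \<notin> extend N S Rs}
        \<le> (if i \<in> S then 0 else 1 + real (Suc L) * \<eta>)"
        using notexp False by simp
      with * show ?thesis by (rule order_trans)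
    qed
  qed
qed simp

text \<open>All \<open>L\<close> blocks are drawn although only the first \<open>T\<close> are read.
  This fixes the number of samples and keeps \<open>T\<close> independent of them.\<close>

definition next_layer :: "nat \<Rightarrow> 'a set \<Rightarrow> 'a set pmf" where
  "next_layer L N = do {B \<leftarrow> replicate_pmf L samples; T \<leftarrow> pmf_of_set {..<L};
     return_pmf (foldl (extend N) {} (take T B))}"

text \<open>As \<open>T\<close> is uniform and independent of the samples, the probability of
  exposure is the sum in \<open>sum_prob_exposed\<close> divided by \<open>L\<close>. The invariant
  fails with small probability at each fixed \<open>T\<close>.\<close>

lemma prob_next_layer_bad:
  assumes "i \<in> N" "N \<subseteq> U" "L > 0"
  shows "measure_pmf.prob (next_layer L N) {S. \<not> well_absorbed N S \<or> exposed N i S}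
    \<le> 1 / real L + \<eta> + real L * real (card U) * \<eta>"
proof -
  let ?S = "\<lambda>T B. foldl (extend N) {} (take T B)"
  let ?pr = "measure_pmf.prob (replicate_pmf L samples)"
  have fin: "finite N" using assms(2) finite_ground finite_subset by blast
  have "next_layer L N = do {T \<leftarrow> pmf_of_set {..<L}; map_pmf (?S T) (replicate_pmf L samples)}"
    unfolding next_layer_def map_pmf_def by (rule bind_commute_pmf)
  then have "measure_pmf.prob (next_layer L N) {S. \<not> well_absorbed N S \<or> exposed N i S}
    = (\<Sum>T<L. ?pr {B. \<not> well_absorbed N (?S T B) \<or> exposed N i (?S T B)}) / real L"
    using assms(3) by (simp add: prob_bind_pmf integral_pmf_of_set measure_map_pmf vimage_def lessThan_empty_iff)
  also have "\<dots> \<le> (\<Sum>T<L. real L * (real (card U) * \<eta>) + ?pr {B. exposed N i (?S T B)}) / real L"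
  proof (intro divide_right_mono sum_mono)
    fix T assume T: "T \<in> {..<L}"
    have "?pr {B. \<not> well_absorbed N (?S T B) \<or> exposed N i (?S T B)}
      \<le> ?pr {B. \<not> well_absorbed N (?S T B)} + ?pr {B. exposed N i (?S T B)}"
      unfolding Collect_disj_eq by (rule measure_subadditive) auto
    also have "?pr {B. \<not> well_absorbed N (?S T B)} \<le> real T * (real (card N) * \<eta>)"
      using T by (intro prob_not_well_absorbed well_absorbed_empty fin) auto
    also have "\<dots> \<le> real L * (real (card U) * \<eta>)"
      using T assms(2) finite_ground \<eta>_nonneg by (intro mult_mono) (auto intro: card_mono)
    finally show "?pr {B. \<not> well_absorbed N (?S T B) \<or> exposed N i (?S T B)}
      \<le> real L * (real (card U) * \<eta>) + ?pr {B. exposed N i (?S T B)}" by simp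
  qed simp
  also have "\<dots> = real L * (real (card U) * \<eta>) + (\<Sum>T<L. ?pr {B. exposed N i (?S T B)}) / real L"
    using assms(3) by (simp add: sum.distrib add_divide_distrib)
  also have "(\<Sum>T<L. ?pr {B. exposed N i (?S T B)}) / real L \<le> (1 + real L * \<eta>) / real L"
    using sum_prob_exposed[OF assms(1), of L "{}"] by (intro divide_right_mono) auto
  also have "\<dots> = 1 / real L + \<eta>" using assms(3) by (simp add: field_simps)
  finally show ?thesis by (simp add: algebra_simps)
qed

end

subsection \<open>The scheme\<close>

text \<open>The samples are an argument and only the stopping times are random, because a scheme is
  a function of its samples. One list of blocks serves one layer.\<close>

primrec chain_pmf :: "'a set \<Rightarrow> 'a set set \<Rightarrow> real \<Rightarrow> nat \<Rightarrow> 'a set list list list \<Rightarrow> 'a set \<Rightarrow> 'a set list pmf" where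
  "chain_pmf U \<I> \<theta> L [] N = return_pmf []"
| "chain_pmf U \<I> \<theta> L (B # Bs) N = do {
     T \<leftarrow> pmf_of_set {..<L};
     let S = foldl (absorb U \<I> \<theta> N) {} (take T B);
     Ss \<leftarrow> chain_pmf U \<I> \<theta> L Bs S;
     return_pmf (S # Ss)}"

text \<open>
  The span is taken of all masked active elements \<open>H\<close> seen so far in the current layer, not only of
  the accepted ones. This is more restrictive, so outputs stay independent, and it makes the decision
  about \<open>i\<close> depend on the active set only through what precedes \<open>i\<close>, not through earlier decisions.
\<close>

primrec chain_accepts :: "'a set set \<Rightarrow> 'a set \<Rightarrow> 'a set list \<Rightarrow> 'a set \<Rightarrow> 'a set \<Rightarrow> 'a \<Rightarrow> bool" where
  "chain_accepts \<I> M [] N H i \<longleftrightarrow> False"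
| "chain_accepts \<I> M (S # Ss) N H i \<longleftrightarrow>
     (if i \<in> S then chain_accepts \<I> M Ss S H i
      else i \<in> N \<inter> M \<and> i \<notin> matroid_span \<I> (H \<inter> M \<inter> N \<union> S))"

section \<open>Cutting the samples into independent blocks\<close>

primrec chunks :: "nat \<Rightarrow> nat \<Rightarrow> 'a list \<Rightarrow> 'a list list" where
  "chunks 0 b xs = []"
| "chunks (Suc a) b xs = take b xs # chunks a b (drop b xs)"

lemma map_chunks_replicate_pmf:
  "map_pmf (chunks a b) (replicate_pmf (a * b) p) = replicate_pmf a (replicate_pmf b p)"
proof (induction a)
  case (Suc a)
  have "map_pmf (chunks (Suc a) b) (replicate_pmf (Suc a * b) p)
    = do {xs \<leftarrow> replicate_pmf b p; ys \<leftarrow> replicate_pmf (a * b) p; return_pmf (xs # chunks a b ys)}"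
    unfolding mult_Suc replicate_pmf_distrib
    by (auto simp: map_bind_pmf set_replicate_pmf intro!: bind_pmf_cong)
  also have "\<dots> = replicate_pmf (Suc a) (replicate_pmf b p)"
    by (simp flip: Suc.IH add: bind_map_pmf)
  finally show ?case .
qed simp

lemma map_map_replicate_pmf:
  "map_pmf (map f) (replicate_pmf n p) = replicate_pmf n (map_pmf f p)"
proof (induction n)
  case (Suc n)
  show ?case by (simp add: map_bind_pmf bind_map_pmf flip: Suc.IH)
qed simp

text \<open>Each of \<open>l\<close> layers receives \<open>L\<close> blocks of \<open>m\<close>
  samples. The mask is internal randomness fixed before the first arrival; the open argument of
  \<open>chain_accepts\<close> is the set of earlier active elements.\<close>

definition sample_scheme :: "nat \<Rightarrow> nat set set \<Rightarrow> real \<Rightarrow> nat \<Rightarrow> nat \<Rightarrow> nat \<Rightarrow> scheme" where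
  "sample_scheme n \<I> \<theta> l L m Ss = do {
     Cs \<leftarrow> chain_pmf {1..n} \<I> \<theta> L (map (chunks L m) (chunks l (L * m) Ss)) {1..n};
     M \<leftarrow> active_pmf {1..n} (\<lambda>_. 1/2);
     return_pmf (chain_accepts \<I> M Cs {1..n})}"

text \<open>Add the elements of \<open>C\<close> to \<open>A\<close> in increasing order: each
  avoids the span of \<open>S\<close> and its predecessors, a set that contains everything collected
  so far.\<close>

lemma indep_Un_of_not_span:
  fixes C :: "'a :: linorder set"
  assumes "matroid U \<I>" "finite C" "A \<in> \<I>" "A \<subseteq> S"
    and "\<And>i. i \<in> C \<Longrightarrow> i \<notin> matroid_span \<I> (C \<inter> {..<i} \<union> S)"
  shows "A \<union> C \<in> \<I>"
  using assms(2,5)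
proof (induction C rule: finite_linorder_max_induct)
  case (insert i C)
  have C: "insert i C \<inter> {..<i} = C" using insert.hyps by auto
  have "A \<union> C \<in> \<I>"
  proof (rule insert.IH)
    fix j assume "j \<in> C"
    then show "j \<notin> matroid_span \<I> (C \<inter> {..<j} \<union> S)"
      using insert.prems[of j] matroid_span_mono[of "C \<inter> {..<j} \<union> S" "insert i C \<inter> {..<j} \<union> S" \<I>] by blast
  qed
  moreover have "i \<notin> matroid_span \<I> (C \<union> S)" using insert.prems[of i] C by simp
  ultimately have "insert i (A \<union> C) \<in> \<I>"
    using assms(4) by (intro matroid.indep_insert[OF assms(1), of "A \<union> C" "C \<union> S"]) auto
  then show ?case by simp
qed (simp add: assms)

lemma chain_accepts_indep:
  fixes R :: "'a :: linorder set"
  assumes "matroid U \<I>" "finite R"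
  shows "{i \<in> R. chain_accepts \<I> M Ss N (R \<inter> {..<i}) i} \<in> \<I>"
proof (induction Ss arbitrary: N)
  case (Cons S Ss)
  \<comment> \<open>Nothing here says that the chain decreases, so the inner output is cut down to
    \<open>S\<close>, just as the branch \<open>i \<in> S\<close> of the definition does.\<close>
  let ?A = "{i \<in> R. chain_accepts \<I> M Ss S (R \<inter> {..<i}) i} \<inter> S"
  let ?C = "{i \<in> R. i \<notin> S \<and> i \<in> N \<inter> M \<and> i \<notin> matroid_span \<I> (R \<inter> {..<i} \<inter> M \<inter> N \<union> S)}"
  have "?A \<union> ?C \<in> \<I>"
  proof (rule indep_Un_of_not_span)
    show "?A \<in> \<I>" by (rule matroid.indep_mono[OF assms(1) Cons.IH[of S]]) blast
    fix i assume "i \<in> ?C"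
    moreover have "matroid_span \<I> (?C \<inter> {..<i} \<union> S) \<subseteq> matroid_span \<I> (R \<inter> {..<i} \<inter> M \<inter> N \<union> S)"
      by (rule matroid_span_mono) blast
    ultimately show "i \<notin> matroid_span \<I> (?C \<inter> {..<i} \<union> S)" by blast
  qed (use assms in auto)
  also have "?A \<union> ?C = {i \<in> R. chain_accepts \<I> M (S # Ss) N (R \<inter> {..<i}) i}" by auto
  finally show ?case .
qed (simp add: matroid.indep_empty[OF assms(1)])

lemma feasible_sample_scheme:
  assumes "matroid {1..n} \<I>"
  shows "feasible_scheme n \<I> k (sample_scheme n \<I> \<theta> l L m)"
  by (auto simp: feasible_scheme_def sample_scheme_def policy_output_def
      intro!: chain_accepts_indep[OF assms] intro: finite_subset[OF _ finite_atLeastAtMost])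

section \<open>Acceptance probability of a fixed element\<close>

context sampled_matroid
begin

abbreviation chains :: "nat \<Rightarrow> nat \<Rightarrow> 'a set \<Rightarrow> 'a set list pmf" where
  "chains L l N \<equiv> bind_pmf (replicate_pmf l (replicate_pmf L samples))
     (\<lambda>Bs. chain_pmf U \<I> (1/2 + 2 * \<delta>) L Bs N)"

text \<open>Drawing the stopping time before the samples of the later layers exhibits the chain as a
  Markov chain with transition \<open>next_layer\<close>.\<close>

lemma chains_Suc:
  "chains L (Suc l) N = do {S \<leftarrow> next_layer L N; Ss \<leftarrow> chains L l S; return_pmf (S # Ss)}"
proof -
  have "chains L (Suc l) N = do {B \<leftarrow> replicate_pmf L samples; Bs \<leftarrow> replicate_pmf l (replicate_pmf L samples);
     T \<leftarrow> pmf_of_set {..<L}; let S = foldl (extend N) {} (take T B);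
     Ss \<leftarrow> chain_pmf U \<I> (1/2 + 2 * \<delta>) L Bs S; return_pmf (S # Ss)}"
    by (simp add: bind_assoc_pmf bind_return_pmf)
  also have "\<dots> = do {B \<leftarrow> replicate_pmf L samples; T \<leftarrow> pmf_of_set {..<L};
     Bs \<leftarrow> replicate_pmf l (replicate_pmf L samples); let S = foldl (extend N) {} (take T B);
     Ss \<leftarrow> chain_pmf U \<I> (1/2 + 2 * \<delta>) L Bs S; return_pmf (S # Ss)}"
    by (intro bind_pmf_cong refl) (rule bind_commute_pmf)
  also have "\<dots> = do {S \<leftarrow> next_layer L N; Ss \<leftarrow> chains L l S; return_pmf (S # Ss)}"
    by (simp add: next_layer_def bind_assoc_pmf bind_return_pmf Let_def)
  finally show ?thesis .
qed

text \<open>Running out of layers counts as failure, since an element of the last set is never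
  accepted.\<close>

primrec settled :: "'a \<Rightarrow> 'a set list \<Rightarrow> 'a set \<Rightarrow> bool" where
  "settled i [] N \<longleftrightarrow> False"
| "settled i (S # Ss) N \<longleftrightarrow> (if i \<in> S then settled i Ss S else \<not> exposed N i S)"

text \<open>Each layer fails with probability bounded by \<open>prob_next_layer_bad\<close>;
  otherwise \<open>i\<close> settles or the rank shrinks by the factor
  \<open>1 - \<delta>\<close>.\<close>

lemma prob_not_settled:
  assumes "i \<in> N" "N \<subseteq> U" "x i > 0" "L > 0" "real (matroid_rank \<I> N) * (1 - \<delta>) ^ l < 1"
  shows "measure_pmf.prob (chains L l N) {Ss. \<not> settled i Ss N}
    \<le> real l * (1 / real L + \<eta> + real L * real (card U) * \<eta>)"
  using assms(1,2,5)
proof (induction l arbitrary: N)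
  case 0
  \<comment> \<open>Without layers left, the rank is below 1 and hence 0, which excludes an element
    with \<open>x i > 0\<close>.\<close>
  then have "sum x N \<le> 0" using sum_le_rank[of N] by simp
  moreover have "x i \<le> sum x N"
    using 0 finite_ground x_range by (intro member_le_sum) (auto intro: finite_subset)
  ultimately show ?case using assms(3) by simp
next
  case (Suc l)
  let ?\<xi> = "1 / real L + \<eta> + real L * real (card U) * \<eta>"
  let ?B = "{S. \<not> well_absorbed N S \<or> exposed N i S}"
  have \<xi>: "?\<xi> \<ge> 0" using \<eta>_nonneg by simp
  have "measure_pmf.prob (chains L (Suc l) N) {Ss. \<not> settled i Ss N}
    = measure_pmf.prob (do {S \<leftarrow> next_layer L N; map_pmf (Cons S) (chains L l S)}) {Ss. \<not> settled i Ss N}"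
    unfolding chains_Suc map_pmf_def ..
  also have "\<dots> \<le> measure_pmf.prob (next_layer L N) ?B + real l * ?\<xi>"
  proof (rule prob_bind_pmf_le)
    fix S assume "S \<notin> ?B"
    then have S: "well_absorbed N S" "\<not> exposed N i S" by auto
    show "measure_pmf.prob (map_pmf (Cons S) (chains L l S)) {Ss. \<not> settled i Ss N} \<le> real l * ?\<xi>"
    proof (cases "i \<in> S")
      case True
      have "real (matroid_rank \<I> S) * (1 - \<delta>) ^ l \<le> (1 - \<delta>) * real (matroid_rank \<I> N) * (1 - \<delta>) ^ l"
        using well_absorbed_rank_le[OF S(1) Suc.prems(2)] \<delta>_le by (intro mult_right_mono) auto
      also have "\<dots> < 1" using Suc.prems(3) by (simp add: mult_ac)
      finally have "measure_pmf.prob (chains L l S) {Ss. \<not> settled i Ss S} \<le> real l * ?\<xi>"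
        using True S(1) Suc.prems(2) by (intro Suc.IH) (auto simp: well_absorbed_def)
      then show ?thesis using True by (simp add: measure_map_pmf vimage_def)
    next
      case False
      then show ?thesis using S(2) \<xi> by (simp add: measure_map_pmf vimage_def)
    qed
  qed (use \<xi> in simp)
  also have "\<dots> \<le> ?\<xi> + real l * ?\<xi>"
    using prob_next_layer_bad[OF Suc.prems(1,2) assms(4)] by simp
  also have "\<dots> = real (Suc l) * ?\<xi>"
    by (simp only: of_nat_Suc distrib_right mult_1_left)
  finally show ?case .
qed

text \<open>\<open>N'\<close> and \<open>S'\<close> are the consecutive sets between which
  \<open>i\<close> drops out; they depend on the chain alone, not on the mask or the active
  elements.\<close>

lemma settled_accepts:
  assumes "settled i Ss N" "i \<in> N"
  obtains N' S' where "span_prob \<I> thinned N' S' i \<le> 1/2 + 3 * \<delta>"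
    "\<And>M H. chain_accepts \<I> M Ss N H i \<longleftrightarrow> i \<in> M \<and> i \<notin> matroid_span \<I> (H \<inter> M \<inter> N' \<union> S')"
  using assms
proof (induction Ss arbitrary: N thesis)
  case (Cons S Ss)
  show ?case
  proof (cases "i \<in> S")
    case True
    then show ?thesis using Cons.IH[of S] Cons.prems by auto
  next
    case False
    then show ?thesis using Cons.prems(1)[of N S] Cons.prems(2,3) by (auto simp: exposed_def not_less)
  qed
qed simp

text \<open>\<open>i\<close> is active and unmasked out with probability \<open>x i / 2\<close>,
  independently of being blocked by the rest of \<open>Q\<close>. The function \<open>before\<close>
  stands for the earlier active elements, as \<open>U\<close> carries no order here.\<close>

lemma prob_accept_of_settled:
  assumes "settled i Ss U" "i \<in> U"
    and before: "\<And>R. i \<notin> before R" "\<And>R. before R \<subseteq> R"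
  shows "measure_pmf.prob (do {M \<leftarrow> active_pmf U (\<lambda>_. 1/2); R \<leftarrow> active_pmf U x;
      return_pmf (i \<in> R \<and> chain_accepts \<I> M Ss U (before R) i)}) {True} \<ge> x i * (1/2) * (1/2 - 3 * \<delta>)"
proof -
  obtain N' S' where *: "span_prob \<I> thinned N' S' i \<le> 1/2 + 3 * \<delta>"
    "\<And>M H. chain_accepts \<I> M Ss U H i \<longleftrightarrow> i \<in> M \<and> i \<notin> matroid_span \<I> (H \<inter> M \<inter> N' \<union> S')"
    using settled_accepts[OF assms(1,2)] by metis
  let ?E = "{Q. i \<in> Q \<and> i \<notin> matroid_span \<I> ((Q - {i}) \<inter> N' \<union> S')}"
  let ?RM = "do {R \<leftarrow> active_pmf U x; M \<leftarrow> active_pmf U (\<lambda>_. 1/2); return_pmf (R, M)}"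
  have "x i * (1/2) * (1/2 - 3 * \<delta>) \<le> x i * (1/2) * (1 - span_prob \<I> thinned N' S' i)"
    using *(1) x_range[OF assms(2)] by (intro mult_left_mono) auto
  also have "1 - span_prob \<I> thinned N' S' i
     = measure_pmf.prob thinned {Q. i \<notin> matroid_span \<I> ((Q - {i}) \<inter> N' \<union> S')}"
    unfolding span_prob_def by (subst measure_pmf.prob_compl[symmetric]) (auto intro: arg_cong[where f = "measure_pmf.prob _"])
  also have "x i * (1/2) * \<dots> = measure_pmf.prob thinned ?E"
    using prob_active_pmf_mem_and[of U i "\<lambda>i. x i * (1/2)" "\<lambda>Q. i \<notin> matroid_span \<I> (Q \<inter> N' \<union> S')"]
      finite_ground assms(2) half_x_range by simp
  also have "thinned = map_pmf (\<lambda>(R, M). R \<inter> M) ?RM"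
    using active_pmf_Int[of U x "\<lambda>_. 1/2"] finite_ground x_range
    by (simp add: map_bind_pmf)
  also have "measure_pmf.prob \<dots> ?E = measure_pmf.prob ?RM {(R, M). R \<inter> M \<in> ?E}"
    unfolding measure_map_pmf vimage_def by (intro arg_cong[where f = "measure_pmf.prob _"]) auto
  also have "\<dots> \<le> measure_pmf.prob ?RM {(R, M). i \<in> R \<and> chain_accepts \<I> M Ss U (before R) i}"
  proof (rule measure_pmf.finite_measure_mono)
    \<comment> \<open>Testing against all of \<open>Q - {i}\<close> instead of the earlier elements
      can only block \<open>i\<close> more often.\<close>
    have "matroid_span \<I> (before R \<inter> M \<inter> N' \<union> S') \<subseteq> matroid_span \<I> ((R \<inter> M - {i}) \<inter> N' \<union> S')" for R M
      using before by (intro matroid_span_mono) blast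
    then show "{(R, M). R \<inter> M \<in> ?E} \<subseteq> {(R, M). i \<in> R \<and> chain_accepts \<I> M Ss U (before R) i}"
      unfolding * by blast
  qed simp
  also have "\<dots> = measure_pmf.prob (map_pmf (\<lambda>(R, M). i \<in> R \<and> chain_accepts \<I> M Ss U (before R) i) ?RM) {True}"
    unfolding measure_map_pmf vimage_def by (intro arg_cong[where f = "measure_pmf.prob _"]) auto
  also have "map_pmf (\<lambda>(R, M). i \<in> R \<and> chain_accepts \<I> M Ss U (before R) i) ?RM
     = do {M \<leftarrow> active_pmf U (\<lambda>_. 1/2); R \<leftarrow> active_pmf U x;
      return_pmf (i \<in> R \<and> chain_accepts \<I> M Ss U (before R) i)}"
    by (simp add: map_bind_pmf) (rule bind_commute_pmf)
  finally show ?thesis .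
qed

end

lemma selectable_sample_scheme:
  fixes n l L m :: nat and \<delta> :: real
  assumes "matroid {1..n} \<I>" "0 < \<delta>" "\<delta> \<le> 1/8" "L > 0" "real n * (1 - \<delta>) ^ l < 1"
    and fail: "real l * (1 / real L + exp (- real m * \<delta>\<^sup>2 / 4) + real L * real n * exp (- real m * \<delta>\<^sup>2 / 4)) \<le> 2 * \<delta>"
  shows "selectable n \<I> (l * (L * m)) (sample_scheme n \<I> (1/2 + 2 * \<delta>) l L m) (1/4 - 2 * \<delta>)"
  unfolding selectable_def
proof (intro ballI impI)
  fix x i assume x: "x \<in> matroid_polytope {1..n} \<I>" and i: "i \<in> {1..n}" "x i > 0"
  interpret matroid "{1..n}" \<I> by fact
  interpret sampled_matroid "{1..n}" \<I> x \<delta> m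
    using x assms by unfold_locales auto
  let ?U = "{1..n}"
  let ?k = "l * (L * m)" and ?sch = "sample_scheme n \<I> (1/2 + 2 * \<delta>) l L m"
  let ?mask = "active_pmf ?U (\<lambda>_. 1/2)" and ?D = "active_pmf ?U x"
  let ?\<P> = "measure_pmf.prob (scheme_outcome n ?k ?sch x)"
  have "map_pmf (\<lambda>Ss. map (chunks L m) (chunks l (L * m) Ss)) (replicate_pmf ?k ?D)
     = map_pmf (map (chunks L m)) (replicate_pmf l (replicate_pmf (L * m) ?D))"
    by (simp flip: map_chunks_replicate_pmf add: map_pmf_comp)
  also have "\<dots> = replicate_pmf l (map_pmf (chunks L m) (replicate_pmf (L * m) ?D))"
    by (rule map_map_replicate_pmf)
  also have "\<dots> = replicate_pmf l (replicate_pmf L samples)"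
    by (simp add: map_chunks_replicate_pmf)
  finally have blocks: "map_pmf (\<lambda>Ss. map (chunks L m) (chunks l (L * m) Ss)) (replicate_pmf ?k ?D)
    = replicate_pmf l (replicate_pmf L samples)" .
  have outcome: "scheme_outcome n ?k ?sch x = do {Cs \<leftarrow> chains L l ?U; M \<leftarrow> ?mask; R \<leftarrow> ?D;
      return_pmf (R, policy_output (chain_accepts \<I> M Cs ?U) R)}"
    unfolding scheme_outcome_def sample_scheme_def blocks[symmetric]
    by (simp add: bind_assoc_pmf bind_return_pmf bind_map_pmf)

  \<comment> \<open>The marginal of \<open>R\<close> gives the denominator \<open>x i\<close> of the
    conditional probability.\<close>
  have "map_pmf fst (scheme_outcome n ?k ?sch x) = ?D"
    unfolding outcome by (simp add: map_bind_pmf bind_return_pmf')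
  then have fst: "?\<P> {\<omega>. i \<in> fst \<omega>} = x i"
    using prob_active_pmf_mem[of ?U i x] i(1) x_range[OF i(1)] measure_map_pmf[of fst "scheme_outcome n ?k ?sch x" "{R. i \<in> R}"]
    by (simp add: vimage_def)

  have "real (matroid_rank \<I> ?U) * (1 - \<delta>) ^ l \<le> real n * (1 - \<delta>) ^ l"
    using rank_le_card[of ?U] assms(3) by (intro mult_right_mono) auto
  then have "real (matroid_rank \<I> ?U) * (1 - \<delta>) ^ l < 1" using assms(5) by simp
  then have "measure_pmf.prob (chains L l ?U) {Ss. \<not> settled i Ss ?U}
      \<le> real l * (1 / real L + \<eta> + real L * real (card ?U) * \<eta>)"
    using i assms(4) by (intro prob_not_settled) auto
  also have "\<dots> \<le> 2 * \<delta>" using fail by (simp add: \<eta>_def)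
  finally have settled: "measure_pmf.prob (chains L l ?U) {Ss. settled i Ss ?U} \<ge> 1 - 2 * \<delta>"
    using measure_pmf.prob_compl[of "{Ss. settled i Ss ?U}" "chains L l ?U"]
    by (simp add: Compl_eq_Diff_UNIV[symmetric] Collect_neg_eq)

  \<comment> \<open>The right side is \<open>1/4 - 2 * \<delta> + 3 * \<delta>^2\<close>: the chance
    of a settled chain, times that of the mask, times that of not being spanned.\<close>
  have "1/4 - 2 * \<delta> \<le> (1 - 2 * \<delta>) * ((1/2) * (1/2 - 3 * \<delta>))"
    by (simp add: field_simps)
  then have "(1/4 - 2 * \<delta>) * x i \<le> (1 - 2 * \<delta>) * ((1/2) * (1/2 - 3 * \<delta>)) * x i"
    using i(2) by (intro mult_right_mono) auto
  also have "\<dots> = (1 - 2 * \<delta>) * (x i * (1/2) * (1/2 - 3 * \<delta>))" by simp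
  also have "\<dots> \<le> measure_pmf.prob (chains L l ?U) {Ss. settled i Ss ?U} * (x i * (1/2) * (1/2 - 3 * \<delta>))"
    using settled i(2) assms(3) by (intro mult_right_mono) auto
  also have "\<dots> \<le> ?\<P> {\<omega>. i \<in> snd \<omega> \<and> i \<in> fst \<omega>}"
    unfolding outcome
  proof (rule prob_bind_pmf_ge)
    fix Cs assume "Cs \<in> {Ss. settled i Ss ?U}"
    then have "x i * (1/2) * (1/2 - 3 * \<delta>) \<le> measure_pmf.prob (do {M \<leftarrow> ?mask; R \<leftarrow> ?D;
      return_pmf (i \<in> R \<and> chain_accepts \<I> M Cs ?U (R \<inter> {..<i}) i)}) {True}"
      using i(1) by (intro prob_accept_of_settled) auto
    also have "do {M \<leftarrow> ?mask; R \<leftarrow> ?D; return_pmf (i \<in> R \<and> chain_accepts \<I> M Cs ?U (R \<inter> {..<i}) i)}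
      = map_pmf (\<lambda>\<omega>. i \<in> snd \<omega> \<and> i \<in> fst \<omega>) (do {M \<leftarrow> ?mask; R \<leftarrow> ?D;
          return_pmf (R, policy_output (chain_accepts \<I> M Cs ?U) R)})"
      by (simp add: map_bind_pmf policy_output_def conj_commute)
    finally show "x i * (1/2) * (1/2 - 3 * \<delta>) \<le> measure_pmf.prob (do {M \<leftarrow> ?mask; R \<leftarrow> ?D;
          return_pmf (R, policy_output (chain_accepts \<I> M Cs ?U) R)}) {\<omega>. i \<in> snd \<omega> \<and> i \<in> fst \<omega>}"
      by (simp only: measure_map_pmf vimage_def) simp
  qed
  finally show "\<P>(\<omega> in scheme_outcome n ?k ?sch x. i \<in> snd \<omega> \<bar> i \<in> fst \<omega>) \<ge> 1/4 - 2 * \<delta>"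
    using i(2) fst by (simp add: cond_prob_def field_simps)
qed

subsection \<open>Choice of parameters\<close>

text \<open>The shift by 2 keeps the logarithm positive for \<open>n = 0\<close> and
  \<open>n = 1\<close>.\<close>

definition log_ceil :: "nat \<Rightarrow> nat" where
  "log_ceil n = nat \<lceil>ln (real n + 2)\<rceil>"

lemma log_ceil_ge: "ln (real n + 2) \<le> real (log_ceil n)"
  by (simp add: log_ceil_def real_nat_ceiling_ge)

lemma log_ceil_pos: "log_ceil n > 0"
proof -
  have "ln (real n + 2) > 0" by simp
  then show ?thesis using log_ceil_ge[of n] by linarith
qed

lemma log_ceil_le: "real (log_ceil n) \<le> ln (real n + 2) + 1"
proof -
  have "ln (real n + 2) > 0" by simp
  then show ?thesis unfolding log_ceil_def by linarith
qed

lemma layers_suffice: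
  fixes \<delta> :: real
  assumes "0 < \<delta>" "\<delta> \<le> 1/8" "real D * \<delta> \<ge> 1"
  shows "real n * (1 - \<delta>) ^ (D * log_ceil n) < 1"
proof -
  have "(1 - \<delta>) ^ (D * log_ceil n) \<le> exp (- \<delta>) ^ (D * log_ceil n)"
    using assms exp_ge_add_one_self[of "- \<delta>"] by (intro power_mono) auto
  also have "\<dots> = exp (- ((real D * \<delta>) * real (log_ceil n)))"
    by (simp flip: exp_of_nat_mult add: mult_ac)
  also have "\<dots> \<le> exp (- ln (real n + 2))"
    using mult_mono[OF assms(3) log_ceil_ge[of n]] assms(1) by simp
  also have "\<dots> = 1 / (real n + 2)" by (simp add: exp_minus divide_simps)
  finally have "real n * (1 - \<delta>) ^ (D * log_ceil n) \<le> real n * (1 / (real n + 2))"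
    by (intro mult_left_mono) auto
  also have "\<dots> < 1" by simp
  finally show ?thesis .
qed

text \<open>The first summand gives \<open>l / L = 1 / D\<close>, at most \<open>\<delta>\<close>.
  In the others, \<open>l * (1 + L * n)\<close> is at most \<open>D^3 * a^3\<close> with
  \<open>a = n + 2\<close>, while the choice of \<open>E\<close> makes the exponential at most
  \<open>a\<close> to the power \<open>- (3 + D^4)\<close>.\<close>

lemma failure_small:
  fixes \<delta> :: real and D E n :: nat
  defines "l \<equiv> D * log_ceil n"
  defines "L \<equiv> D * l"
  assumes "0 < \<delta>" "real D * \<delta> \<ge> 1" "real E * \<delta>\<^sup>2 / 4 \<ge> real (3 + D ^ 4)"
  shows "real l * (1 / real L + exp (- real (E * log_ceil n) * \<delta>\<^sup>2 / 4)
    + real L * real n * exp (- real (E * log_ceil n) * \<delta>\<^sup>2 / 4)) \<le> 2 * \<delta>"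
proof -
  define \<eta> where "\<eta> = exp (- real (E * log_ceil n) * \<delta>\<^sup>2 / 4)"
  define a where "a = real n + 2"
  have D: "D > 0" using assms(4) by (cases D) auto
  have invD: "1 / real D \<le> \<delta>" using assms(4) D by (simp add: field_simps)
  have a: "a \<ge> 2" by (simp add: a_def)
  have "real (3 + D ^ 4) * ln a \<le> (real E * \<delta>\<^sup>2 / 4) * real (log_ceil n)"
    using assms(5) log_ceil_ge[of n] a by (intro mult_mono) (auto simp: a_def)
  then have "\<eta> \<le> exp (- (real (3 + D ^ 4) * ln a))"
    by (simp add: \<eta>_def mult_ac)
  also have "\<dots> = inverse (a ^ (3 + D ^ 4))"
    using a by (simp only: exp_minus exp_of_nat_mult exp_ln)
  finally have \<eta>: "\<eta> \<le> inverse (a ^ (3 + D ^ 4))" .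

  have "ln a \<le> a - 1" using a by (intro ln_le_minus_one) simp
  then have lc: "real (log_ceil n) \<le> a" using log_ceil_le[of n] by (simp add: a_def)
  then have "real l \<le> real D * a" by (simp add: l_def mult_left_mono)
  moreover have "1 + real L * real n \<le> (real D)\<^sup>2 * a\<^sup>2"
  proof -
    have "real L \<le> (real D)\<^sup>2 * a" using lc D by (simp add: L_def l_def power2_eq_square)
    then have "real L * real n \<le> (real D)\<^sup>2 * a * real n" by (intro mult_right_mono) auto
    moreover have "1 \<le> (real D)\<^sup>2 * a" using D a by (intro mult_ge1_I) auto
    ultimately have "1 + real L * real n \<le> (real D)\<^sup>2 * a * (real n + 1)" by (simp add: algebra_simps)
    also have "\<dots> \<le> (real D)\<^sup>2 * a * a" using a by (intro mult_left_mono) (auto simp: a_def)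
    finally show ?thesis by (simp add: power2_eq_square mult.assoc)
  qed
  ultimately have "real l * (1 + real L * real n) \<le> (real D * a) * ((real D)\<^sup>2 * a\<^sup>2)"
    by (intro mult_mono) auto
  also have "\<dots> = real D ^ 3 * a ^ 3" by (simp add: power2_eq_square power3_eq_cube)
  finally have lL: "real l * (1 + real L * real n) \<le> real D ^ 3 * a ^ 3" .
  have "real l * (1 + real L * real n) * \<eta> \<le> real D ^ 3 * a ^ 3 * inverse (a ^ (3 + D ^ 4))"
    by (rule mult_mono[OF lL \<eta>]) (use a in \<open>simp_all add: \<eta>_def\<close>)
  also have "\<dots> = real D ^ 3 * inverse (a ^ (D ^ 4))"
    using a by (simp add: power_add)
  \<comment> \<open>The exponent \<open>D^4\<close> serves to absorb the constant
    \<open>D^3\<close>: \<open>D^4 <= 2^(D^4) <= a^(D^4)\<close> leaves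
    \<open>1 / D\<close>.\<close>
  also have "inverse (a ^ (D ^ 4)) \<le> inverse (real D ^ 4)"
  proof (rule le_imp_inverse_le)
    have "real D ^ 4 \<le> 2 ^ (D ^ 4)" using of_nat_less_two_power[of "D ^ 4", where ?'a = real] by simp
    also have "\<dots> \<le> a ^ (D ^ 4)" using a by (intro power_mono) auto
    finally show "real D ^ 4 \<le> a ^ (D ^ 4)" .
  qed (use D in auto)
  then have "real D ^ 3 * inverse (a ^ (D ^ 4)) \<le> real D ^ 3 * inverse (real D ^ 4)"
    by (intro mult_left_mono) auto
  also have "\<dots> = 1 / real D" using D by (simp add: field_simps power_numeral_reduce)
  finally have "real l * (1 + real L * real n) * \<eta> \<le> \<delta>" using invD by simp
  moreover have "real l / real L = 1 / real D"
    using D log_ceil_pos[of n] by (simp add: L_def l_def)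
  ultimately show ?thesis
    using invD unfolding \<eta>_def[symmetric] by (simp add: algebra_simps)
qed

theorem theorem4p1:
  fixes \<epsilon> :: real
  assumes "\<epsilon> > 0"
  shows "\<exists>(k :: nat \<Rightarrow> nat) (sch :: nat \<Rightarrow> nat set set \<Rightarrow> scheme).
           (\<lambda>n. real (k n)) \<in> O(\<lambda>n. ln (real n) ^ 4) \<and>
           (\<forall>n \<I>. matroid {1..n} \<I> \<longrightarrow>
              feasible_scheme n \<I> (k n) (sch n \<I>) \<and>
              selectable n \<I> (k n) (sch n \<I>) (1/4 - \<epsilon>))"
proof -
  \<comment> \<open>The loss \<open>2 * \<delta>\<close> must not exceed \<open>\<epsilon>\<close>;
    the cap \<open>1/8\<close> is the one required by \<open>sampled_matroid\<close>.\<close>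
  define \<delta> where "\<delta> = min (\<epsilon> / 2) (1/8)"
  define D where "D = nat \<lceil>1 / \<delta>\<rceil>"
  define E where "E = nat \<lceil>real (3 + D ^ 4) * 4 / \<delta>\<^sup>2\<rceil>"
  define l where "l n = D * log_ceil n" for n
  define L where "L n = D * l n" for n
  define m where "m n = E * log_ceil n" for n
  define k where "k n = l n * (L n * m n)" for n
  define sch where "sch n \<I> = sample_scheme n \<I> (1/2 + 2 * \<delta>) (l n) (L n) (m n)" for n \<I>
  have \<delta>: "0 < \<delta>" "\<delta> \<le> 1/8" "2 * \<delta> \<le> \<epsilon>" using assms by (auto simp: \<delta>_def)
  have "1 / \<delta> \<le> real D" unfolding D_def by (rule real_nat_ceiling_ge)
  then have D: "real D * \<delta> \<ge> 1" using \<delta> by (simp add: field_simps)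
  then have "D > 0" by (cases D) auto
  have "real (3 + D ^ 4) * 4 / \<delta>\<^sup>2 \<le> real E" unfolding E_def by (rule real_nat_ceiling_ge)
  then have E: "real E * \<delta>\<^sup>2 / 4 \<ge> real (3 + D ^ 4)" using \<delta> by (simp add: field_simps)

  \<comment> \<open>The three logarithmic factors come from the layers, the rounds per layer and the
    samples per round.\<close>
  define C where "C = real D ^ 3 * real E"
  have "real (k n) \<le> C * (ln (real n + 2) + 1) ^ 3" for n
  proof -
    have "real (k n) = C * real (log_ceil n) ^ 3"
      by (simp add: k_def l_def L_def m_def C_def power3_eq_cube)
    also have "\<dots> \<le> C * (ln (real n + 2) + 1) ^ 3"
      using log_ceil_le by (intro mult_left_mono power_mono) (auto simp: C_def)
    finally show ?thesis .
  qed
  then have "(\<lambda>n. real (k n)) \<in> O(\<lambda>n. C * (ln (real n + 2) + 1) ^ 3)"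
    by (intro bigoI[of _ 1] always_eventually allI) (simp add: order_trans[OF _ abs_ge_self])
  also have "(\<lambda>n. C * (ln (real n + 2) + 1) ^ 3) \<in> O(\<lambda>n. ln (real n) ^ 4)"
    by real_asymp
  finally have "(\<lambda>n. real (k n)) \<in> O(\<lambda>n. ln (real n) ^ 4)" .
  moreover have "selectable n \<I> (k n) (sch n \<I>) (1/4 - \<epsilon>)" if "matroid {1..n} \<I>" for n \<I>
  proof -
    have "L n > 0" using \<open>D > 0\<close> log_ceil_pos by (simp add: L_def l_def)
    then have "selectable n \<I> (k n) (sch n \<I>) (1/4 - 2 * \<delta>)"
      unfolding k_def sch_def
      using \<delta> that layers_suffice[OF \<delta>(1,2) D, of n] failure_small[OF \<delta>(1) D E, of n]
      by (intro selectable_sample_scheme) (simp_all add: l_def L_def m_def)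
    then show ?thesis using \<delta>(3) unfolding selectable_def by force
  qed
  moreover have "feasible_scheme n \<I> (k n) (sch n \<I>)" if "matroid {1..n} \<I>" for n \<I>
    unfolding sch_def using that by (rule feasible_sample_scheme)
  ultimately show ?thesis by blast
qed

end
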